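(* Let $S=(S_n)_{n\ge0}$ be a random walk with non-degenerate i.i.d. real steps and $S_0=0$, and let $R_n$ be its number of weak records up to step $n$. Suppose that either $\mathrm{P}(S_n\ge0)\to\rho$ with $0<\rho<1$, or $\mathrm{P}(S_n\ge0)\to0$ (put $\rho=0$) and $\sum_{k=1}^\infty\frac{\mathrm{P}(S_k\ge0)}{k}=\infty$. Let $a(n)>0$ satisfy $a(n)\to\infty$ and $\frac{a(n)}{n^{1-\rho}}\to0$ as $n\to\infty$. Then for every $y>0$, $$\lim_{n\to\infty}\frac{1}{a(n)^{1/(1-\rho)}}\log\mathrm{P}\left(\frac{R_n}{C_\rho\Big(1-\frac{a(n)^{1/(1-\rho)}}{n}\Big)n^\rho a(n)}\ge y\right)=-(1-\rho)\left(\rho^\rho y\right)^{1/(1-\rho)}.$$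
   Context: $X_1,X_2,\dots$ are i.i.d. non-degenerate real random variables, $S_0=0$, $S_n=\sum_{i=1}^nX_i$. A weak record occurs at step $n$ if $S_n=\max_{0\le k\le n}S_k$; $S_0$ is counted as the first record. $R_n$ is the number of weak records among steps $0,1,\dots,n$ (so $R_0=1$). For $0\le y<1$, $C_\rho(y)=\exp\big[\sum_{k=1}^\infty\frac{y^k}{k}(\mathrm{P}(S_k\ge0)-\rho)\big]$. Convention: $0^0=1$. *)

theory Defs
  imports "HOL-Probability.Probability"
begin

text \<open>The step written \<open>X\<^sub>i\<close> with \<open>i \<ge> 1\<close> in the mathematics is \<open>X (i - 1)\<close> here.\<close>

definition walk :: "(nat \<Rightarrow> 'a \<Rightarrow> real) \<Rightarrow> nat \<Rightarrow> 'a \<Rightarrow> real" where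
  "walk X n \<omega> = (\<Sum>i<n. X i \<omega>)"

definition weak_record :: "(nat \<Rightarrow> 'a \<Rightarrow> real) \<Rightarrow> nat \<Rightarrow> 'a \<Rightarrow> bool" where
  "weak_record X n \<omega> \<longleftrightarrow> walk X n \<omega> = Max ((\<lambda>k. walk X k \<omega>) ` {0..n})"

definition num_records :: "(nat \<Rightarrow> 'a \<Rightarrow> real) \<Rightarrow> nat \<Rightarrow> 'a \<Rightarrow> nat" where
  "num_records X n \<omega> = card {m \<in> {0..n}. weak_record X m \<omega>}"

definition prob_nonneg :: "'a measure \<Rightarrow> (nat \<Rightarrow> 'a \<Rightarrow> real) \<Rightarrow> nat \<Rightarrow> real" where
  "prob_nonneg M X n = \<P>(\<omega> in M. walk X n \<omega> \<ge> 0)"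

text \<open>The sum over \<open>k \<ge> 1\<close> is reindexed to start at \<open>0\<close>. It converges for \<open>0 \<le> y < 1\<close>;
  other values of \<open>y\<close> carry no meaning.\<close>

definition C_fun :: "'a measure \<Rightarrow> (nat \<Rightarrow> 'a \<Rightarrow> real) \<Rightarrow> real \<Rightarrow> real \<Rightarrow> real" where
  "C_fun M X \<rho> y =
     exp (\<Sum>k. y ^ Suc k / real (Suc k) * (prob_nonneg M X (Suc k) - \<rho>))"

text \<open>Real power with \<open>0\<^sup>0 = 1\<close>, whereas \<open>0 powr 0 = 0\<close>.\<close>

definition rpow :: "real \<Rightarrow> real \<Rightarrow> real" where
  "rpow x p = (if p = 0 then 1 else x powr p)"

end

theory Submission
  imports Defs
begin

text \<open>
  With \<open>T\<^sub>r\<close> the \<open>r\<close>-th weak ladder epoch, \<open>R\<^sub>n > r\<close> iff \<open>T\<^sub>r \<le> n\<close>, and \<open>T\<^sub>r\<close> is a sum of \<open>r\<close> independent copies of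
  \<open>T\<^sub>1\<close>. Feller's cyclic argument gives \<open>P(S\<^sub>n \<ge> 0) / n = (\<Sum>r. P(T\<^sub>r = n) / r)\<close>, hence
  \<open>1 - E s^T\<^sub>1 = exp (- (\<Sum>k. s^k P(S\<^sub>k \<ge> 0) / k)) = (1 - s) powr \<rho> / C\<^sub>\<rho>(s)\<close>, which is regularly varying of index \<open>\<rho>\<close>
  at \<open>s = 1\<close>. Put \<open>b n = a n powr (1 / (1 - \<rho>))\<close>. The normalisation in the theorem is
  \<open>b n / (1 - E s^T\<^sub>1)\<close> at \<open>s = 1 - b n / n\<close>, so for \<open>r\<close> equal to \<open>y\<close> times it,
  \<open>ln (E exp (- \<theta> b n T\<^sub>r / n)) / b n\<close> tends to \<open>- y \<theta> powr \<rho>\<close> for all \<open>\<theta> > 0\<close>. Exponential tilting turns this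
  into the asymptotics of \<open>ln P(T\<^sub>r \<le> n) / b n\<close>, whose limit is the infimum of \<open>\<theta> - y \<theta> powr \<rho>\<close> over \<open>\<theta> > 0\<close>.
\<close>

subsection \<open>Records of deterministic walks\<close>

definition psum :: "(nat \<Rightarrow> real) \<Rightarrow> nat \<Rightarrow> real" where
  "psum x n = (\<Sum>i<n. x i)"

definition is_rec :: "(nat \<Rightarrow> real) \<Rightarrow> nat \<Rightarrow> bool" where
  "is_rec x m \<longleftrightarrow> (\<forall>k\<le>m. psum x k \<le> psum x m)"

text \<open>The initial record at 0 is left out so that counts add up when the walk is restarted at
  a record.\<close>

definition rec_count :: "(nat \<Rightarrow> real) \<Rightarrow> nat \<Rightarrow> nat" where
  "rec_count x n = card {m \<in> {1..n}. is_rec x m}"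

text \<open>\<open>ladder r n x\<close>: the \<open>r\<close>-th weak ladder epoch of the walk with steps \<open>x\<close> equals \<open>n\<close>; the initial record
  at \<open>0\<close> is the \<open>0\<close>-th one.\<close>

definition ladder :: "nat \<Rightarrow> nat \<Rightarrow> (nat \<Rightarrow> real) \<Rightarrow> bool" where
  "ladder r n x \<longleftrightarrow> is_rec x n \<and> rec_count x n = r"

lemma psum_cong: "(\<And>i. i < n \<Longrightarrow> x i = z i) \<Longrightarrow> psum x n = psum z n"
  unfolding psum_def by (intro sum.cong) auto

lemma is_rec_cong: "(\<And>i. i < n \<Longrightarrow> x i = z i) \<Longrightarrow> is_rec x n = is_rec z n"
proof -
  assume a: "\<And>i. i < n \<Longrightarrow> x i = z i"
  have "psum x k = psum z k" if "k \<le> n" for k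
    using a that by (intro psum_cong) auto
  then show ?thesis unfolding is_rec_def by auto
qed

lemma rec_count_cong:
  assumes "\<And>i. i < n \<Longrightarrow> x i = z i"
  shows "rec_count x n = rec_count z n"
proof -
  have "is_rec x m = is_rec z m" if "m \<le> n" for m
    using assms that by (intro is_rec_cong) auto
  then show ?thesis unfolding rec_count_def by (intro arg_cong[where f = card]) auto
qed

lemma ladder_cong: "(\<And>i. i < n \<Longrightarrow> x i = z i) \<Longrightarrow> ladder r n x = ladder r n z"
  unfolding ladder_def using is_rec_cong rec_count_cong by metis

lemma is_rec_0 [simp]: "is_rec x 0"
  by (simp add: is_rec_def)

lemma rec_count_0 [simp]: "rec_count x 0 = 0"
  by (simp add: rec_count_def)

lemma rec_count_Suc: "rec_count x (Suc n) = rec_count x n + of_bool (is_rec x (Suc n))"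
proof -
  have "{m \<in> {1..Suc n}. is_rec x m}
      = (if is_rec x (Suc n) then insert (Suc n) {m \<in> {1..n}. is_rec x m} else {m \<in> {1..n}. is_rec x m})"
    by (auto simp: le_Suc_eq)
  then show ?thesis unfolding rec_count_def by auto
qed

lemma rec_count_mono: "m \<le> n \<Longrightarrow> rec_count x m \<le> rec_count x n"
  by (rule lift_Suc_mono_le[of "rec_count x"]) (auto simp: rec_count_Suc)

lemma rec_count_le: "rec_count x n \<le> n"
  by (induction n) (auto simp: rec_count_Suc)

lemma rec_count_strict:
  assumes "m < n" "is_rec x n" shows "rec_count x m < rec_count x n"
proof -
  obtain k where k: "n = Suc k" using assms by (cases n) auto
  then have "rec_count x m \<le> rec_count x k" using assms by (intro rec_count_mono) auto
  then show ?thesis using assms k by (simp add: rec_count_Suc)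
qed

text \<open>Every record raises \<open>rec_count\<close>, so no value is taken at two records. This
  later makes the events "the \<open>r\<close>-th epoch is \<open>j\<close>" disjoint in
  \<open>j\<close>.\<close>

lemma ladder_unique: "ladder r j x \<Longrightarrow> ladder r k x \<Longrightarrow> j = k"
  unfolding ladder_def by (metis nat_neq_iff rec_count_strict)

lemma ladder_0_iff: "ladder 0 n x \<longleftrightarrow> n = 0"
  using ladder_unique[of 0 n x 0] by (auto simp: ladder_def)

lemma ladder_at_0: "ladder r 0 x \<longleftrightarrow> r = 0"
  by (auto simp: ladder_def)

lemma ladder_index_le: "ladder r n x \<Longrightarrow> r \<le> n"
  unfolding ladder_def using rec_count_le by blast

text \<open>\<open>rec_count\<close> starts at 0, grows by at most one at a time and only at
  records, so every value up to the current one is first reached at a record.\<close>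

lemma ladder_exists:
  assumes "r \<le> rec_count x n" shows "\<exists>m\<le>n. ladder r m x"
  using assms
proof (induction n)
  case 0
  then show ?case by (simp add: ladder_at_0)
next
  case (Suc n)
  show ?case
  proof (cases "r \<le> rec_count x n")
    case True
    then show ?thesis using Suc.IH le_Suc_eq by blast
  next
    case False
    then have "ladder r (Suc n) x"
      using Suc.prems unfolding ladder_def rec_count_Suc by (cases "is_rec x (Suc n)") auto
    then show ?thesis by blast
  qed
qed

text \<open>Duality between counting records and locating ladder epochs; through it the law of the
  count is read off from the laws of the epochs.\<close>

lemma rec_count_ge_iff: "r \<le> rec_count x n \<longleftrightarrow> (\<exists>m\<le>n. ladder r m x)"
  using ladder_exists rec_count_mono unfolding ladder_def by blast

section \<open>Restarting the walk at a record, and cyclic rearrangements\<close>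

lemma psum_shift: "psum (\<lambda>i. x (j + i)) k = psum x (j + k) - psum x j"
  by (induction k) (auto simp: psum_def)

text \<open>A record at \<open>j\<close> dominates all earlier positions, so a later position only
  has to be compared with those from \<open>j\<close> on.\<close>

lemma is_rec_shift:
  assumes "is_rec x j" shows "is_rec x (j + k) \<longleftrightarrow> is_rec (\<lambda>i. x (j + i)) k"
proof
  assume "is_rec x (j + k)"
  then show "is_rec (\<lambda>i. x (j + i)) k" unfolding is_rec_def by (auto simp: psum_shift)
next
  assume a: "is_rec (\<lambda>i. x (j + i)) k"
  show "is_rec x (j + k)" unfolding is_rec_def
  proof (intro allI impI)
    fix i assume i: "i \<le> j + k"
    have jk: "psum x j \<le> psum x (j + k)"
      using a[unfolded is_rec_def psum_shift, rule_format, of 0] by simp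
    show "psum x i \<le> psum x (j + k)"
    proof (cases "i \<le> j")
      case True
      then show ?thesis using assms jk unfolding is_rec_def by force
    next
      case False
      then have "i - j \<le> k" "j + (i - j) = i" using i by auto
      then show ?thesis using a[unfolded is_rec_def psum_shift, rule_format, of "i - j"] by simp
    qed
  qed
qed

lemma rec_count_shift:
  assumes "is_rec x j"
  shows "rec_count x (j + k) = rec_count x j + rec_count (\<lambda>i. x (j + i)) k"
  by (induction k) (auto simp: rec_count_Suc is_rec_shift[OF assms, of "Suc _", simplified])

text \<open>Pathwise renewal structure: cut the path at its \<open>r\<close>-th epoch. By additivity
  of the count, what remains must end at the first epoch of the restarted walk.\<close>

lemma ladder_Suc_iff:
  "ladder (Suc r) n x \<longleftrightarrow> (\<exists>j\<le>n. ladder r j x \<and> ladder 1 (n - j) (\<lambda>i. x (j + i)))"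
proof
  assume a: "ladder (Suc r) n x"
  then obtain j where j: "j \<le> n" "ladder r j x"
    using ladder_exists[of r x n] unfolding ladder_def by auto
  then have "ladder 1 (n - j) (\<lambda>i. x (j + i))"
    using a is_rec_shift[of x j "n - j"] rec_count_shift[of x j "n - j"] by (auto simp: ladder_def)
  then show "\<exists>j\<le>n. ladder r j x \<and> ladder 1 (n - j) (\<lambda>i. x (j + i))" using j by blast
next
  assume "\<exists>j\<le>n. ladder r j x \<and> ladder 1 (n - j) (\<lambda>i. x (j + i))"
  then obtain j where j: "j \<le> n" "ladder r j x" "ladder 1 (n - j) (\<lambda>i. x (j + i))" by blast
  then show "ladder (Suc r) n x"
    using is_rec_shift[of x j "n - j"] rec_count_shift[of x j "n - j"] by (auto simp: ladder_def)
qed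

text \<open>Moving the window by one trades \<open>P \<nu>\<close> for \<open>P (\<nu> + n)\<close>,
  which agree by periodicity, so the count does not depend on where the window starts.\<close>

lemma card_periodic_window:
  fixes P :: "nat \<Rightarrow> bool"
  assumes "\<And>j. P (j + n) = P j"
  shows "card {k \<in> {1..n}. P (\<nu> + k)} = card {j. j < n \<and> P j}"
proof -
  have eq: "card {k \<in> {1..n}. P (\<nu> + k)} = (\<Sum>k<n. of_bool (P (\<nu> + Suc k)))" for \<nu>
  proof -
    have "card {k \<in> {1..n}. P (\<nu> + k)} = card (Suc ` {k. k < n \<and> P (\<nu> + Suc k)})"
      by (intro arg_cong[where f = card]) (auto simp: image_iff Bex_def intro!: gr0_implies_Suc dest: Suc_le_D)
    also have "\<dots> = (\<Sum>k<n. of_bool (P (\<nu> + Suc k)))"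
      by (subst card_image) (auto simp: sum.If_cases of_bool_def Int_def)
    finally show ?thesis .
  qed
  have step: "(\<Sum>k<n. of_bool (P (Suc \<nu> + k))) = (\<Sum>k<n. of_bool (P (\<nu> + k)) :: nat)" for \<nu>
  proof -
    have "(\<Sum>k<Suc n. of_bool (P (\<nu> + k)) :: nat) = of_bool (P \<nu>) + (\<Sum>k<n. of_bool (P (Suc \<nu> + k)))"
      by (subst sum.lessThan_Suc_shift) simp
    moreover have "(\<Sum>k<Suc n. of_bool (P (\<nu> + k)) :: nat) = of_bool (P \<nu>) + (\<Sum>k<n. of_bool (P (\<nu> + k)))"
      using assms[of \<nu>] by simp
    ultimately show ?thesis by simp
  qed
  have "(\<Sum>k<n. of_bool (P (\<nu> + k))) = (\<Sum>k<n. of_bool (P k) :: nat)" for \<nu>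
    by (induction \<nu>) (use step in auto)
  from this[of "Suc \<nu>"] have "(\<Sum>k<n. of_bool (P (\<nu> + Suc k))) = (\<Sum>k<n. of_bool (P k) :: nat)" by simp
  then show ?thesis unfolding eq by (auto simp: sum.If_cases of_bool_def Int_def)
qed

text \<open>Extend the cyclic rearrangements of \<open>x\<close> to a walk \<open>psum z\<close> with \<open>n\<close>-periodic steps. The rotation by
  \<open>\<nu>\<close> has a ladder epoch at \<open>n\<close> iff \<open>\<nu> + n\<close> is a record of \<open>psum z\<close> over the preceding period (\<open>G \<nu>\<close>), and
  then its ladder epochs up to \<open>n\<close> are exactly the good positions of one period. So the \<open>R\<close> good
  rotations contribute \<open>1 / R\<close> each.\<close>

lemma cyclic_ladder_sum:
  fixes x :: "nat \<Rightarrow> real"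
  assumes n: "n \<ge> 1"
  shows "(\<Sum>\<nu><n. \<Sum>r\<in>{1..n}. of_bool (ladder r n (\<lambda>i. x ((\<nu> + i) mod n))) / real r)
       = of_bool (psum x n \<ge> 0)"
proof -
  define z where "z = (\<lambda>i. x (i mod n))"
  define d where "d = psum x n"
  define G where "G = (\<lambda>j. \<forall>k\<le>n. psum z (j + k) \<le> psum z (j + n))"
  have rot: "psum (\<lambda>i. x ((\<nu> + i) mod n)) k = psum z (\<nu> + k) - psum z \<nu>" for \<nu> k
    using psum_shift[of z \<nu> k] by (simp add: z_def)
  have dz: "psum z n = d" unfolding d_def by (rule psum_cong) (simp add: z_def)
  have per: "psum z (j + n) = psum z j + d" for j
  proof -
    have "psum z (n + j) - psum z n = psum z j"
      unfolding psum_shift[symmetric] by (rule psum_cong) (simp add: z_def)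
    then show ?thesis using dz by (simp add: add.commute)
  qed
  have perG: "G (j + n) = G j" for j
  proof -
    have "psum z (j + n + k) = psum z (j + k) + d" for k
      using per[of "j + k"] by (simp add: ac_simps)
    then show ?thesis unfolding G_def by simp
  qed
  define R where "R = card {j. j < n \<and> G j}"
  have good: "is_rec (\<lambda>i. x ((\<nu> + i) mod n)) n \<longleftrightarrow> G \<nu>" for \<nu>
    unfolding is_rec_def rot G_def by simp
  have count: "rec_count (\<lambda>i. x ((\<nu> + i) mod n)) n = R" if g: "G \<nu>" for \<nu>
  proof -
    have "is_rec (\<lambda>i. x ((\<nu> + i) mod n)) k \<longleftrightarrow> G (\<nu> + k)" if k: "k \<in> {1..n}" for k
    proof
      assume a: "is_rec (\<lambda>i. x ((\<nu> + i) mod n)) k"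
      then have a: "psum z (\<nu> + i) \<le> psum z (\<nu> + k)" if "i \<le> k" for i
        using that unfolding is_rec_def rot by auto
      show "G (\<nu> + k)" unfolding G_def
      proof (intro allI impI)
        fix i assume i: "i \<le> n"
        \<comment> \<open>Positions from \<open>\<nu> + n\<close> on are moved back by one period
          into the range of \<open>a\<close>. Earlier ones lie below \<open>\<nu> + n\<close>
          because \<open>\<nu>\<close> is good, and \<open>a\<close> at 0, raised by one period,
          leads from there to \<open>\<nu> + k + n\<close>.\<close>
        show "psum z (\<nu> + k + i) \<le> psum z (\<nu> + k + n)"
        proof (cases "n \<le> k + i")
          case True
          then have "\<nu> + k + i = \<nu> + (k + i - n) + n" by simp
          moreover have "psum z (\<nu> + (k + i - n)) \<le> psum z (\<nu> + k)" using i by (intro a) simp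
          ultimately show ?thesis by (simp only: per add_le_cancel_right)
        next
          case False
          then have "psum z (\<nu> + (k + i)) \<le> psum z (\<nu> + n)" using g unfolding G_def by auto
          then show ?thesis using a[of 0] per[of \<nu>] per[of "\<nu> + k"] by (simp add: ac_simps)
        qed
      qed
    next
      assume G: "G (\<nu> + k)"
      show "is_rec (\<lambda>i. x ((\<nu> + i) mod n)) k" unfolding is_rec_def rot
      proof (intro allI impI)
        fix i assume i: "i \<le> k"
        \<comment> \<open>One period later, \<open>\<nu> + i\<close> lies in the stretch of length
          \<open>n\<close> that \<open>G (\<nu> + k)\<close> compares, at offset
          \<open>n + i - k\<close>.\<close>
        have "\<nu> + k + (n + i - k) = \<nu> + i + n" "n + i - k \<le> n" using i k by auto
        then have "psum z (\<nu> + i + n) \<le> psum z (\<nu> + k + n)"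
          using G[unfolded G_def, rule_format, of "n + i - k"] by (simp add: ac_simps)
        then show "psum z (\<nu> + i) - psum z \<nu> \<le> psum z (\<nu> + k) - psum z \<nu>" by (simp add: per)
      qed
    qed
    then have "rec_count (\<lambda>i. x ((\<nu> + i) mod n)) n = card {k \<in> {1..n}. G (\<nu> + k)}"
      unfolding rec_count_def by (intro arg_cong[where f = card]) auto
    then show ?thesis unfolding R_def using card_periodic_window[of G n \<nu>] perG by simp
  qed
  have R_le: "R \<le> n" unfolding R_def using card_mono[of "{..<n}" "{j. j < n \<and> G j}"] by auto
  have R_pos: "R \<ge> 1" if "G \<nu>" "\<nu> < n" for \<nu>
  proof -
    have "{j. j < n \<and> G j} \<noteq> {}" using that by blast
    then show ?thesis unfolding R_def by (simp add: Suc_le_eq card_gt_0_iff)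
  qed
  have inner: "(\<Sum>r\<in>{1..n}. of_bool (ladder r n (\<lambda>i. x ((\<nu> + i) mod n))) / real r) = of_bool (G \<nu>) / real R"
    if "\<nu> < n" for \<nu>
  proof (cases "G \<nu>")
    case True
    then have "(\<Sum>r\<in>{1..n}. of_bool (ladder r n (\<lambda>i. x ((\<nu> + i) mod n))) / real r)
        = (\<Sum>r\<in>{1..n}. if r = R then 1 / real R else 0)"
      unfolding ladder_def good count[OF True] by (intro sum.cong) auto
    also have "\<dots> = 1 / real R" using R_pos[OF True that] R_le by simp
    finally show ?thesis using True by simp
  next
    case False
    then show ?thesis unfolding ladder_def good by simp
  qed
  have "(\<Sum>\<nu><n. \<Sum>r\<in>{1..n}. of_bool (ladder r n (\<lambda>i. x ((\<nu> + i) mod n))) / real r)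
     = (\<Sum>\<nu><n. of_bool (G \<nu>) / real R)"
    using inner by (intro sum.cong) auto
  also have "\<dots> = real R / real R"
    unfolding sum_divide_distrib[symmetric] R_def
    by (auto simp: sum.If_cases of_bool_def Int_def)
  \<comment> \<open>If no rotation is good, the quotient is \<open>0 / 0 = 0\<close>, which is the
    value wanted for \<open>d < 0\<close>. It remains to see that some rotation is good exactly if
    \<open>d \<ge> 0\<close>.\<close>
  also have "\<dots> = of_bool (d \<ge> 0)"
  proof (cases "d \<ge> 0")
    case True
    \<comment> \<open>A maximal position within one period is good: positions in the next period are
      at most \<open>d\<close> higher than their copies in this one.\<close>
    obtain \<nu> where nu: "\<nu> < n" "\<And>j. j < n \<Longrightarrow> psum z j \<le> psum z \<nu>"
    proof -
      have fin: "finite (psum z ` {..<n})" "psum z ` {..<n} \<noteq> {}" using n by (auto simp: lessThan_empty_iff)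
      from Max_in[OF this] obtain \<nu> where "\<nu> < n" "psum z \<nu> = Max (psum z ` {..<n})" by auto
      then show ?thesis using that Max_ge[OF fin(1)] by auto
    qed
    have "G \<nu>" unfolding G_def
    proof (intro allI impI)
      fix k assume k: "k \<le> n"
      show "psum z (\<nu> + k) \<le> psum z (\<nu> + n)"
      proof (cases "\<nu> + k < n")
        case True
        then show ?thesis using nu(2)[of "\<nu> + k"] \<open>d \<ge> 0\<close> per[of \<nu>] by simp
      next
        case False
        then have "\<nu> + k = \<nu> + k - n + n" "\<nu> + k - n < n" using k nu by auto
        then show ?thesis using nu(2)[of "\<nu> + k - n"] per by (metis add_le_cancel_right)
      qed
    qed
    then show ?thesis using R_pos[of \<nu>] nu True by simp
  next
    case False
    have "\<not> G j" for j
    proof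
      assume "G j"
      then have "psum z (j + 0) \<le> psum z (j + n)" unfolding G_def by blast
      then show False using False per[of j] by simp
    qed
    then have "R = 0" unfolding R_def by simp
    then show ?thesis using False by simp
  qed
  finally show ?thesis by (simp add: d_def)
qed

subsection \<open>Logarithmic power series near 1\<close>

lemma ln_one_minus_sums:
  fixes s :: real
  assumes "0 \<le> s" "s < 1"
  shows "(\<lambda>k. s ^ Suc k / real (Suc k)) sums (- ln (1 - s))"
proof -
  have "(\<lambda>n. - (s ^ n) / real n) sums ln (1 - s)"
    using ln_series'[of "- s"] assms by simp
  then have "(\<lambda>n. - (- (s ^ n) / real n)) sums (- ln (1 - s))" by (rule sums_minus)
  then show ?thesis by (subst sums_Suc_iff) simp
qed

text \<open>For \<open>c k = P(S_k \<ge> 0)\<close> the exponential of this series will be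
  \<open>1 / (1 - ladder_gf s)\<close>; for the centred coefficients \<open>c k - \<rho>\<close> it
  is \<open>C_fun\<close>.\<close>

definition log_series :: "(nat \<Rightarrow> real) \<Rightarrow> real \<Rightarrow> real" where
  "log_series c s = (\<Sum>k. s ^ Suc k / real (Suc k) * c (Suc k))"

lemma log_series_summable:
  assumes "\<And>k. \<bar>c k\<bar> \<le> B" "0 \<le> s" "s < 1"
  shows "summable (\<lambda>k. s ^ Suc k / real (Suc k) * c (Suc k))"
proof (rule summable_comparison_test'[where N = 0])
  show "summable (\<lambda>k. s ^ Suc k / real (Suc k) * B)"
    using sums_summable[OF ln_one_minus_sums[OF assms(2,3)]] by (rule summable_mult2)
  show "norm (s ^ Suc k / real (Suc k) * c (Suc k)) \<le> s ^ Suc k / real (Suc k) * B" for k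
    unfolding norm_mult using assms by (intro mult_mono) auto
qed

lemma log_series_sums:
  assumes "\<And>k. \<bar>c k\<bar> \<le> B" "0 \<le> s" "s < 1"
  shows "(\<lambda>k. s ^ Suc k / real (Suc k) * c (Suc k)) sums log_series c s"
  unfolding log_series_def using log_series_summable[OF assms] by (rule summable_sums)

lemma log_series_shift:
  assumes "\<And>k. \<bar>c k\<bar> \<le> B" "0 \<le> s" "s < 1"
  shows "log_series (\<lambda>k. c k - r) s = log_series c s + r * ln (1 - s)"
proof -
  have "(\<lambda>k. s ^ Suc k / real (Suc k) * c (Suc k) - s ^ Suc k / real (Suc k) * r)
      sums (log_series c s - (- ln (1 - s)) * r)"
    by (intro sums_diff sums_mult2 ln_one_minus_sums log_series_sums[where c = c and B = B] assms)
  then have "(\<lambda>k. s ^ Suc k / real (Suc k) * (c (Suc k) - r)) sums (log_series c s + r * ln (1 - s))"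
    by (simp only: right_diff_distrib) (simp add: mult.commute)
  then show ?thesis unfolding log_series_def by (simp only: sums_iff)
qed

text \<open>Split the difference of the series at \<open>K\<close>. The first terms are bounded by
  \<open>B\<close>. In the tail the coefficients are at most \<open>e\<close>, and the increments
  \<open>d k\<close> are nonnegative with total \<open>ln (1 - u) - ln (1 - v)\<close>.\<close>

lemma log_series_diff_le:
  assumes B: "\<And>k. \<bar>c k\<bar> \<le> B" and e: "\<And>k. k \<ge> K \<Longrightarrow> \<bar>c (Suc k)\<bar> \<le> e"
    and "0 \<le> u" "u \<le> v" "v < 1"
  shows "\<bar>log_series c u - log_series c v\<bar>
       \<le> B * (\<Sum>k<K. \<bar>u ^ Suc k - v ^ Suc k\<bar>) + e * \<bar>ln (1 - u) - ln (1 - v)\<bar>"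
proof -
  define d where "d = (\<lambda>k. (v ^ Suc k - u ^ Suc k) / real (Suc k))"
  have B0: "0 \<le> B" using B[of 0] by simp
  have e0: "0 \<le> e" using e[of K] by simp
  have pw: "u ^ Suc k \<le> v ^ Suc k" for k using assms by (intro power_mono)
  have d0: "0 \<le> d k" for k using pw[of k] by (simp add: d_def)
  have d_sums: "d sums (ln (1 - u) - ln (1 - v))"
    using sums_diff[OF ln_one_minus_sums[of v] ln_one_minus_sums[of u]] assms
    by (simp add: d_def diff_divide_distrib)
  have "(\<lambda>k. d k * c (Suc k)) sums (log_series c v - log_series c u)"
    using sums_diff[OF log_series_sums[OF B, of v] log_series_sums[OF B, of u]] assms
    by (simp add: d_def diff_divide_distrib left_diff_distrib)
  then have eq: "(\<Sum>k. d k * c (Suc k)) = log_series c v - log_series c u"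
    and sm: "summable (\<lambda>k. d k * c (Suc k))" by (auto simp: sums_iff)
  define h where "h = (\<lambda>k. (if k \<in> {..<K} then B * \<bar>u ^ Suc k - v ^ Suc k\<bar> else 0) + e * d k)"
  have h_sums: "h sums (B * (\<Sum>k<K. \<bar>u ^ Suc k - v ^ Suc k\<bar>) + e * (ln (1 - u) - ln (1 - v)))"
    unfolding h_def sum_distrib_left by (intro sums_add sums_mult d_sums sums_If_finite_set) simp
  have bound: "\<bar>d k * c (Suc k)\<bar> \<le> h k" for k
  proof (cases "k < K")
    case True
    have "d k \<le> \<bar>u ^ Suc k - v ^ Suc k\<bar>"
      using pw[of k] divide_left_mono[of 1 "real (Suc k)" "v ^ Suc k - u ^ Suc k"] by (simp add: d_def)
    then have "d k * \<bar>c (Suc k)\<bar> \<le> \<bar>u ^ Suc k - v ^ Suc k\<bar> * B"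
      using B B0 by (intro mult_mono) auto
    then show ?thesis using True d0[of k] e0 by (simp add: h_def abs_mult mult.commute add_increasing2)
  next
    case False
    then have "d k * \<bar>c (Suc k)\<bar> \<le> d k * e" using e d0 by (intro mult_left_mono) auto
    then show ?thesis using False d0[of k] by (simp add: h_def abs_mult mult.commute)
  qed
  have "\<bar>\<Sum>k. d k * c (Suc k)\<bar> \<le> (\<Sum>k. h k)"
    using bound h_sums sm
    by (intro summable_rabs[THEN order_trans] suminf_le)
       (auto simp: sums_iff intro: summable_comparison_test'[of h 0])
  then have "\<bar>log_series c v - log_series c u\<bar> \<le> B * (\<Sum>k<K. \<bar>u ^ Suc k - v ^ Suc k\<bar>) + e * (ln (1 - u) - ln (1 - v))"
    unfolding eq using sums_unique[OF h_sums] by simp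
  moreover have "ln (1 - v) \<le> ln (1 - u)" using assms by simp
  ultimately show ?thesis by (simp add: abs_minus_commute[of "log_series c u"])
qed

lemma log_series_diff_bound:
  assumes B: "\<And>k. \<bar>c k\<bar> \<le> B" and e: "\<And>k. k \<ge> K \<Longrightarrow> \<bar>c (Suc k)\<bar> \<le> e"
    and "0 \<le> u" "u < 1" "0 \<le> v" "v < 1"
  shows "\<bar>log_series c u - log_series c v\<bar>
       \<le> B * (\<Sum>k<K. \<bar>u ^ Suc k - v ^ Suc k\<bar>) + e * \<bar>ln (1 - u) - ln (1 - v)\<bar>"
proof (cases "u \<le> v")
  case True
  show ?thesis by (rule log_series_diff_le[where c = c and B = B and K = K and e = e]) (use True assms in auto)
next
  case False
  have "\<bar>log_series c v - log_series c u\<bar>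
       \<le> B * (\<Sum>k<K. \<bar>v ^ Suc k - u ^ Suc k\<bar>) + e * \<bar>ln (1 - v) - ln (1 - u)\<bar>"
    by (rule log_series_diff_le[where c = c and B = B and K = K and e = e]) (use False assms in auto)
  then show ?thesis by (simp only: abs_minus_commute)
qed

text \<open>The finite part of the preceding bound vanishes because both arguments tend to 1. The
  logarithmic part tends to \<open>e * \<bar>ln t\<bar>\<close>, where \<open>e\<close> can be taken
  arbitrarily small since \<open>c\<close> tends to 0.\<close>

lemma log_series_slowly_varying:
  assumes B: "\<And>k. \<bar>c k\<bar> \<le> B" and c: "c \<longlonglongrightarrow> 0"
    and u: "u \<longlonglongrightarrow> 1" "\<forall>\<^sub>F n in sequentially. 0 < u n \<and> u n < 1"
    and v: "v \<longlonglongrightarrow> 1" "\<forall>\<^sub>F n in sequentially. 0 < v n \<and> v n < 1"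
    and t: "(\<lambda>n. (1 - v n) / (1 - u n)) \<longlonglongrightarrow> t" "t > 0"
  shows "(\<lambda>n. log_series c (u n) - log_series c (v n)) \<longlonglongrightarrow> 0"
proof (rule tendstoI)
  fix \<epsilon> :: real assume "\<epsilon> > 0"
  \<comment> \<open>The summand 1 keeps the quotient meaningful for \<open>t = 1\<close> and gives
    \<open>e * \<bar>ln t\<bar> < \<epsilon>\<close> strictly.\<close>
  define e where "e = \<epsilon> / (\<bar>ln t\<bar> + 1)"
  have "e > 0" using \<open>\<epsilon> > 0\<close> by (simp add: e_def add_pos_nonneg)
  obtain K where K: "\<And>k. k \<ge> K \<Longrightarrow> \<bar>c k\<bar> < e"
    using LIMSEQ_D[OF c \<open>e > 0\<close>] by auto
  have K': "\<bar>c (Suc k)\<bar> \<le> e" if "k \<ge> K" for k using K[of "Suc k"] that by simp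
  have "(\<lambda>n. ln ((1 - v n) / (1 - u n))) \<longlonglongrightarrow> ln t" using t by (intro tendsto_ln) auto
  then have "(\<lambda>n. ln (1 - v n) - ln (1 - u n)) \<longlonglongrightarrow> ln t"
    by (rule Lim_transform_eventually) (use u(2) v(2) in eventually_elim, simp add: ln_div)
  then have "(\<lambda>n. B * (\<Sum>k<K. \<bar>u n ^ Suc k - v n ^ Suc k\<bar>) + e * \<bar>ln (1 - v n) - ln (1 - u n)\<bar>)
      \<longlonglongrightarrow> B * (\<Sum>k<K. \<bar>1 ^ Suc k - 1 ^ Suc k\<bar>) + e * \<bar>ln t\<bar>"
    by (intro tendsto_intros u(1) v(1))
  moreover have "e * \<bar>ln t\<bar> < \<epsilon>"
    using \<open>\<epsilon> > 0\<close> by (simp add: e_def divide_simps add_pos_nonneg abs_add_one_gt_zero)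
  ultimately have "\<forall>\<^sub>F n in sequentially.
      B * (\<Sum>k<K. \<bar>u n ^ Suc k - v n ^ Suc k\<bar>) + e * \<bar>ln (1 - v n) - ln (1 - u n)\<bar> < \<epsilon>"
    by (intro order_tendstoD(2)) auto
  then show "\<forall>\<^sub>F n in sequentially. dist (log_series c (u n) - log_series c (v n)) 0 < \<epsilon>"
    using u(2) v(2)
  proof eventually_elim
    case (elim n)
    have "\<bar>log_series c (u n) - log_series c (v n)\<bar>
       \<le> B * (\<Sum>k<K. \<bar>u n ^ Suc k - v n ^ Suc k\<bar>) + e * \<bar>ln (1 - u n) - ln (1 - v n)\<bar>"
      by (rule log_series_diff_bound[where c = c and B = B and K = K and e = e]) (use elim B K' in auto)
    then show ?case using elim(1) by (simp only: dist_real_def diff_0_right abs_minus_commute)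
  qed
qed

text \<open>Write \<open>c k\<close> as \<open>(c k - r) + r\<close>: the first part is slowly
  varying, and the constant part is an explicit logarithm that contributes
  \<open>r * ln t\<close>.\<close>

lemma log_series_regularly_varying:
  assumes B: "\<And>k. \<bar>c k\<bar> \<le> B" and c: "c \<longlonglongrightarrow> r"
    and u: "u \<longlonglongrightarrow> 1" "\<forall>\<^sub>F n in sequentially. 0 < u n \<and> u n < 1"
    and v: "v \<longlonglongrightarrow> 1" "\<forall>\<^sub>F n in sequentially. 0 < v n \<and> v n < 1"
    and t: "(\<lambda>n. (1 - v n) / (1 - u n)) \<longlonglongrightarrow> t" "t > 0"
  shows "(\<lambda>n. log_series c (u n) - log_series c (v n)) \<longlonglongrightarrow> r * ln t"
proof -
  have B': "\<bar>c k - r\<bar> \<le> B + \<bar>r\<bar>" for k using B[of k] by linarith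
  have c': "(\<lambda>k. c k - r) \<longlonglongrightarrow> 0" using c by (simp add: LIM_zero_iff)
  have "(\<lambda>n. ln ((1 - v n) / (1 - u n))) \<longlonglongrightarrow> ln t" using t by (intro tendsto_ln) auto
  then have "(\<lambda>n. (log_series (\<lambda>k. c k - r) (u n) - log_series (\<lambda>k. c k - r) (v n))
      + r * ln ((1 - v n) / (1 - u n))) \<longlonglongrightarrow> 0 + r * ln t"
    by (intro tendsto_add tendsto_mult tendsto_const log_series_slowly_varying[OF B' c' u v t])
  then have "(\<lambda>n. (log_series (\<lambda>k. c k - r) (u n) - log_series (\<lambda>k. c k - r) (v n))
      + r * ln ((1 - v n) / (1 - u n))) \<longlonglongrightarrow> r * ln t" by simp
  then show ?thesis
  proof (rule Lim_transform_eventually)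
    show "\<forall>\<^sub>F n in sequentially. (log_series (\<lambda>k. c k - r) (u n) - log_series (\<lambda>k. c k - r) (v n))
      + r * ln ((1 - v n) / (1 - u n)) = log_series c (u n) - log_series c (v n)"
      using u(2) v(2)
    proof eventually_elim
      case (elim n)
      then show ?case
        using log_series_shift[where c = c and B = B and s = "u n" and r = r]
          log_series_shift[where c = c and B = B and s = "v n" and r = r] B
        by (simp add: ln_div algebra_simps)
    qed
  qed
qed

text \<open>As \<open>c\<close> is nonnegative, every partial sum is a lower bound. It is continuous
  at 1, and its value there is arbitrarily large by divergence.\<close>

lemma log_series_at_top:
  assumes c: "\<And>k. 0 \<le> c k" "\<And>k. c k \<le> 1"
    and ns: "\<not> summable (\<lambda>k. c (Suc k) / real (Suc k))"
    and u: "u \<longlonglongrightarrow> 1" "\<forall>\<^sub>F n in sequentially. 0 < u n \<and> u n < 1"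
  shows "filterlim (\<lambda>n. log_series c (u n)) at_top sequentially"
  unfolding filterlim_at_top
proof
  fix Z :: real
  have "\<exists>K. (\<Sum>k<K. c (Suc k) / real (Suc k)) > Z"
  proof (rule ccontr)
    assume "\<not> ?thesis"
    then have "summable (\<lambda>k. c (Suc k) / real (Suc k))"
      using c(1) by (intro bounded_imp_summable[where B = Z])
        (auto simp: not_less lessThan_Suc_atMost[symmetric] simp del: sum.lessThan_Suc of_nat_Suc)
    then show False using ns by simp
  qed
  then obtain K where K: "(\<Sum>k<K. c (Suc k) / real (Suc k)) > Z" by blast
  have "(\<lambda>n. \<Sum>k<K. u n ^ Suc k / real (Suc k) * c (Suc k)) \<longlonglongrightarrow> (\<Sum>k<K. 1 ^ Suc k / real (Suc k) * c (Suc k))"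
    by (intro tendsto_intros u(1)) auto
  moreover have "(\<Sum>k<K. 1 ^ Suc k / real (Suc k) * c (Suc k)) > Z" using K by simp
  ultimately have "\<forall>\<^sub>F n in sequentially. (\<Sum>k<K. u n ^ Suc k / real (Suc k) * c (Suc k)) > Z"
    by (intro order_tendstoD(1)) auto
  then show "\<forall>\<^sub>F n in sequentially. Z \<le> log_series c (u n)"
    using u(2)
  proof eventually_elim
    case (elim n)
    have "summable (\<lambda>k. u n ^ Suc k / real (Suc k) * c (Suc k))"
      by (rule log_series_summable[where B = 1]) (use elim c in \<open>auto simp: abs_of_nonneg\<close>)
    then have "(\<Sum>k<K. u n ^ Suc k / real (Suc k) * c (Suc k)) \<le> log_series c (u n)"
      unfolding log_series_def using elim c(1) by (intro sum_le_suminf) auto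
    then show ?case using elim by simp
  qed
qed

text \<open>Comparison with the harmonic series. It supplies for \<open>\<rho> > 0\<close> the
  divergence that is assumed for \<open>\<rho> = 0\<close>, so that both cases continue
  together.\<close>

lemma not_summable_of_limit_pos:
  fixes c :: "nat \<Rightarrow> real"
  assumes "c \<longlonglongrightarrow> r" "r > 0"
  shows "\<not> summable (\<lambda>k. c (Suc k) / real (Suc k))"
proof
  assume "summable (\<lambda>k. c (Suc k) / real (Suc k))"
  then have s: "summable (\<lambda>k. c k / real k)" by (subst (asm) summable_Suc_iff)
  have "\<forall>\<^sub>F k in sequentially. c k > r / 2" using assms by (intro order_tendstoD(1)) auto
  then have "\<forall>\<^sub>F k in sequentially. norm (r / 2 * inverse (real k)) \<le> c k / real k"
    by eventually_elim (use assms in \<open>simp add: divide_simps\<close>)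
  then have "summable (\<lambda>k. r / 2 * inverse (real k))"
    using s by (rule summable_comparison_test_ev)
  then have "summable (\<lambda>k. inverse (real k))" using assms by (subst (asm) summable_cmult_iff) auto
  then show False using not_summable_harmonic[where ?'a = real] by simp
qed

subsection \<open>The generating function of the first ladder epoch\<close>

text \<open>The event depends on the first \<open>n\<close> steps only. Stated on the finite product
  space, it can be pulled back along any choice of \<open>n\<close> steps.\<close>

lemma measurable_ladder:
  "{x \<in> space (PiM {..<n} (\<lambda>_. borel :: real measure)). ladder r n x} \<in> sets (PiM {..<n} (\<lambda>_. borel))"
proof -
  have P: "(\<lambda>x. psum x m) \<in> borel_measurable (PiM {..<n} (\<lambda>_. borel :: real measure))"
    if "m \<le> n" for m
    unfolding psum_def using that by (intro borel_measurable_sum measurable_component_singleton) auto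
  have R: "Measurable.pred (PiM {..<n} (\<lambda>_. borel :: real measure)) (\<lambda>x. is_rec x m)"
    if "m \<le> n" for m
  proof -
    have "Measurable.pred (PiM {..<n} (\<lambda>_. borel :: real measure)) (\<lambda>x. \<forall>k\<in>{..m}. psum x k \<le> psum x m)"
    proof (intro pred_intros_finite)
      fix k assume "k \<in> {..m}"
      then have "k \<le> n" using that by simp
      show "Measurable.pred (PiM {..<n} (\<lambda>_. borel :: real measure)) (\<lambda>x. psum x k \<le> psum x m)"
        unfolding pred_def by (intro borel_measurable_le P \<open>k \<le> n\<close> \<open>m \<le> n\<close>)
    qed simp
    moreover have "is_rec x m = (\<forall>k\<in>{..m}. psum x k \<le> psum x m)" for x
      by (auto simp: is_rec_def)
    ultimately show ?thesis by (simp only:)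
  qed
  have "{x \<in> space (PiM {..<n} (\<lambda>_. borel :: real measure)). m \<in> {k \<in> {1..n}. is_rec x k}}
      \<in> sets (PiM {..<n} (\<lambda>_. borel))" for m
  proof (cases "m \<in> {1..n}")
    case True
    then have "m \<le> n" by simp
    have "(m \<in> {k \<in> {1..n}. is_rec x k}) = is_rec x m" for x using True by blast
    then show ?thesis using R[OF \<open>m \<le> n\<close>] by (simp only: pred_def)
  next
    case False
    then have "{x \<in> space (PiM {..<n} (\<lambda>_. borel :: real measure)). m \<in> {k \<in> {1..n}. is_rec x k}} = {}" by blast
    then show ?thesis by (simp only: sets.empty_sets)
  qed
  then have C: "(\<lambda>x. rec_count x n) \<in> measurable (PiM {..<n} (\<lambda>_. borel :: real measure)) (count_space UNIV)"
    unfolding rec_count_def by (rule measurable_card)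
  have "(\<lambda>x. rec_count x n) -` {r} \<inter> space (PiM {..<n} (\<lambda>_. borel :: real measure)) \<in> sets (PiM {..<n} (\<lambda>_. borel))"
    by (rule measurable_sets[OF C]) simp
  from sets.Int[OF this R[OF order_refl, unfolded pred_def]] show ?thesis
    by (rule back_subst[where P = "\<lambda>A. A \<in> sets _"]) (auto simp: ladder_def)
qed

section \<open>Laws of the ladder epochs of a walk with i.i.d. steps\<close>

locale iid_steps = prob_space M for M :: "'a measure" +
  fixes X :: "nat \<Rightarrow> 'a \<Rightarrow> real"
  assumes indep: "indep_vars (\<lambda>_. borel) X UNIV"
    and ident: "distr M borel (X i) = distr M borel (X 0)"
begin

lemma X_measurable [measurable]: "X i \<in> borel_measurable M"
  using indep unfolding indep_vars_def by auto

text \<open>The law of the whole sequence is a product of identical factors, and reindexing along an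
  injection preserves it. The injections of interest are shifts and cyclic rotations.\<close>

lemma distr_restrict_inj:
  assumes "inj_on f {..<n}"
  shows "distr M (PiM {..<n} (\<lambda>_. borel)) (\<lambda>\<omega>. \<lambda>i\<in>{..<n}. X (f i) \<omega>)
       = PiM {..<n} (\<lambda>_. distr M borel (X 0))"
proof -
  let ?D = "distr M borel (X 0)"
  let ?g = "\<lambda>x. \<lambda>i\<in>{..<n}. x (f i)"
  have "distr M (PiM UNIV (\<lambda>_. borel)) (\<lambda>\<omega>. \<lambda>i\<in>UNIV. X i \<omega>) = PiM UNIV (\<lambda>i. distr M borel (X i))"
    using indep by (subst (asm) indep_vars_iff_distr_eq_PiM) auto
  also have "\<dots> = PiM UNIV (\<lambda>_. ?D)" by (intro PiM_cong refl ident)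
  finally have D: "distr M (PiM UNIV (\<lambda>_. borel)) (\<lambda>\<omega>. \<lambda>i\<in>UNIV. X i \<omega>) = PiM UNIV (\<lambda>_. ?D)" .
  have sets_D: "sets (PiM {..<n} (\<lambda>_. ?D)) = sets (PiM {..<n} (\<lambda>_. borel))"
    by (intro sets_PiM_cong) auto
  have g: "?g \<in> measurable (PiM UNIV (\<lambda>_. borel)) (PiM {..<n} (\<lambda>_. borel))"
    by (intro measurable_restrict measurable_component_singleton) auto
  have "PiM {..<n} (\<lambda>_. ?D) = distr (PiM UNIV (\<lambda>_. ?D)) (PiM {..<n} (\<lambda>_. ?D)) ?g"
    by (intro distr_PiM_reindex[symmetric] assms prob_space_distr) auto
  also have "\<dots> = distr (PiM UNIV (\<lambda>_. ?D)) (PiM {..<n} (\<lambda>_. borel)) ?g"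
    by (intro distr_cong refl sets_D)
  also have "\<dots> = distr M (PiM {..<n} (\<lambda>_. borel)) (?g \<circ> (\<lambda>\<omega>. \<lambda>i\<in>UNIV. X i \<omega>))"
    unfolding D[symmetric] by (intro distr_distr g measurable_restrict) simp
  finally show ?thesis by (simp add: comp_def)
qed

text \<open>As a function of \<open>n\<close> this is the law of the \<open>r\<close>-th epoch on
  finite times; its total mass is at most 1.\<close>

definition ladder_prob :: "nat \<Rightarrow> nat \<Rightarrow> real" where
  "ladder_prob r n = \<P>(\<omega> in M. ladder r n (\<lambda>i. X i \<omega>))"

lemma ladder_restrict: "ladder r n (\<lambda>i\<in>{..<n}. x i) = ladder r n x"
  by (rule ladder_cong) simp

lemma prob_ladder_inj:
  assumes "inj_on f {..<n}"
  shows "\<P>(\<omega> in M. ladder r n (\<lambda>i. X (f i) \<omega>)) = ladder_prob r n"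
proof -
  let ?A = "{x \<in> space (PiM {..<n} (\<lambda>_. borel :: real measure)). ladder r n x}"
  have *: "\<P>(\<omega> in M. ladder r n (\<lambda>i. X (f i) \<omega>)) = measure (PiM {..<n} (\<lambda>_. distr M borel (X 0))) ?A"
    if "inj_on f {..<n}" for f
  proof -
    have m: "(\<lambda>\<omega>. \<lambda>i\<in>{..<n}. X (f i) \<omega>) \<in> measurable M (PiM {..<n} (\<lambda>_. borel))"
      by (intro measurable_restrict) simp
    have "measure (PiM {..<n} (\<lambda>_. distr M borel (X 0))) ?A
        = prob ((\<lambda>\<omega>. \<lambda>i\<in>{..<n}. X (f i) \<omega>) -` ?A \<inter> space M)"
      unfolding distr_restrict_inj[OF that, symmetric] by (rule measure_distr[OF m measurable_ladder])
    also have "(\<lambda>\<omega>. \<lambda>i\<in>{..<n}. X (f i) \<omega>) -` ?A \<inter> space M = {\<omega> \<in> space M. ladder r n (\<lambda>i. X (f i) \<omega>)}"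
      using measurable_space[OF m] by (auto simp: ladder_restrict)
    finally show ?thesis by simp
  qed
  show ?thesis using *[OF assms] *[of id] unfolding ladder_prob_def by simp
qed

lemma ladder_event [measurable]:
  "{\<omega> \<in> space M. ladder r n (\<lambda>i. X (f i) \<omega>)} \<in> sets M"
proof -
  have m: "(\<lambda>\<omega>. \<lambda>i\<in>{..<n}. X (f i) \<omega>) \<in> measurable M (PiM {..<n} (\<lambda>_. borel))"
    by (intro measurable_restrict) simp
  have "{\<omega> \<in> space M. ladder r n (\<lambda>i. X (f i) \<omega>)}
      = (\<lambda>\<omega>. \<lambda>i\<in>{..<n}. X (f i) \<omega>) -` {x \<in> space (PiM {..<n} (\<lambda>_. borel :: real measure)). ladder r n x} \<inter> space M"
    using measurable_space[OF m] by (auto simp: ladder_restrict)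
  then show ?thesis using measurable_sets[OF m measurable_ladder] by simp
qed

lemma ladder_prob_nonneg: "0 \<le> ladder_prob r n" and ladder_prob_le_1: "ladder_prob r n \<le> 1"
  by (auto simp: ladder_prob_def)

lemma ladder_prob_0: "ladder_prob 0 n = of_bool (n = 0)"
  by (cases "n = 0") (auto simp: ladder_prob_def ladder_0_iff prob_space)

lemma ladder_prob_at_0: "ladder_prob r 0 = of_bool (r = 0)"
  by (cases "r = 0") (auto simp: ladder_prob_def ladder_at_0 prob_space)

lemma ladder_prob_eq_0: "n < r \<Longrightarrow> ladder_prob r n = 0"
proof -
  assume "n < r"
  then have "{\<omega> \<in> space M. ladder r n (\<lambda>i. X i \<omega>)} = {}" by (auto dest: ladder_index_le)
  then show ?thesis unfolding ladder_prob_def by (simp only: measure_empty)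
qed

text \<open>The two events are decided by the disjoint blocks \<open>{..<j}\<close> and
  \<open>{j..<n}\<close> of steps, and the second block has the law of the first
  \<open>n - j\<close> steps.\<close>

lemma prob_ladder_then:
  assumes "j \<le> n"
  shows "\<P>(\<omega> in M. ladder r j (\<lambda>i. X i \<omega>) \<and> ladder 1 (n - j) (\<lambda>i. X (j + i) \<omega>)) = ladder_prob r j * ladder_prob 1 (n - j)"
proof -
  let ?P = "\<lambda>K. PiM K (\<lambda>_. borel :: real measure)"
  let ?A = "{x \<in> space (?P {..<j}). ladder r j x}"
  let ?g = "\<lambda>x. \<lambda>i\<in>{..<n - j}. x (j + i)"
  have g: "?g \<in> measurable (?P {j..<n}) (?P {..<n - j})"
    by (intro measurable_restrict measurable_component_singleton) auto
  let ?B = "?g -` {x \<in> space (?P {..<n - j}). ladder 1 (n - j) x} \<inter> space (?P {j..<n})"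
  have B: "?B \<in> sets (?P {j..<n})" by (rule measurable_sets[OF g measurable_ladder])
  have "indep_var (?P {..<j}) (\<lambda>\<omega>. restrict (\<lambda>i. X i \<omega>) {..<j}) (?P {j..<n}) (\<lambda>\<omega>. restrict (\<lambda>i. X i \<omega>) {j..<n})"
    by (rule indep_var_restrict[OF indep]) auto
  note D = indep_varD[OF this measurable_ladder B, of r]
  have m: "(\<lambda>\<omega>. restrict (\<lambda>i. X i \<omega>) K) \<in> measurable M (?P K)" for K
    by (intro measurable_restrict) simp
  have eqA: "(\<lambda>\<omega>. restrict (\<lambda>i. X i \<omega>) {..<j}) -` ?A \<inter> space M = {\<omega> \<in> space M. ladder r j (\<lambda>i. X i \<omega>)}"
    using measurable_space[OF m] by (auto simp: ladder_restrict)
  have cong: "ladder 1 (n - j) (?g (restrict (\<lambda>i. X i \<omega>) {j..<n})) = ladder 1 (n - j) (\<lambda>i. X (j + i) \<omega>)" for \<omega>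
    by (rule ladder_cong) auto
  have eqB: "(\<lambda>\<omega>. restrict (\<lambda>i. X i \<omega>) {j..<n}) -` ?B \<inter> space M
      = {\<omega> \<in> space M. ladder 1 (n - j) (\<lambda>i. X (j + i) \<omega>)}"
  proof -
    have "restrict (\<lambda>i. X i \<omega>) {j..<n} \<in> ?B \<longleftrightarrow> ladder 1 (n - j) (\<lambda>i. X (j + i) \<omega>)" if "\<omega> \<in> space M" for \<omega>
    proof -
      have r: "restrict (\<lambda>i. X i \<omega>) {j..<n} \<in> space (?P {j..<n})" by (rule measurable_space[OF m that])
      then have "?g (restrict (\<lambda>i. X i \<omega>) {j..<n}) \<in> space (?P {..<n - j})" by (rule measurable_space[OF g])
      then show ?thesis using r cong[of \<omega>] by (simp only: vimage_eq Int_iff mem_Collect_eq simp_thms)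
    qed
    then show ?thesis by blast
  qed
  have eqAB: "(\<lambda>\<omega>. (restrict (\<lambda>i. X i \<omega>) {..<j}, restrict (\<lambda>i. X i \<omega>) {j..<n})) -` (?A \<times> ?B) \<inter> space M
      = {\<omega> \<in> space M. ladder r j (\<lambda>i. X i \<omega>) \<and> ladder 1 (n - j) (\<lambda>i. X (j + i) \<omega>)}"
    using eqA eqB by blast
  show ?thesis
    using D unfolding eqA eqB eqAB ladder_prob_def[of r j, symmetric]
    by (subst (asm) prob_ladder_inj) (auto simp: inj_on_def)
qed

text \<open>Renewal equation: the \<open>r\<close>-th epoch \<open>j\<close> is unique, so
  \<open>ladder_Suc_iff\<close> decomposes the event into disjoint pieces.\<close>

lemma ladder_prob_Suc: "ladder_prob (Suc r) n = (\<Sum>j\<le>n. ladder_prob r j * ladder_prob 1 (n - j))"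
proof -
  let ?E = "\<lambda>j. {\<omega> \<in> space M. ladder r j (\<lambda>i. X i \<omega>) \<and> ladder 1 (n - j) (\<lambda>i. X (j + i) \<omega>)}"
  have E: "?E j \<in> sets M" for j
  proof -
    have eq: "?E j = {\<omega> \<in> space M. ladder r j (\<lambda>i. X i \<omega>)} \<inter> {\<omega> \<in> space M. ladder 1 (n - j) (\<lambda>i. X (j + i) \<omega>)}"
      by blast
    show ?thesis
      unfolding eq by (rule sets.Int[OF ladder_event[of r j "\<lambda>i. i"] ladder_event[of 1 "n - j" "\<lambda>i. j + i"]])
  qed
  have "{\<omega> \<in> space M. ladder (Suc r) n (\<lambda>i. X i \<omega>)} = (\<Union>j\<in>{..n}. ?E j)"
    unfolding ladder_Suc_iff[of r n] by blast
  then have "ladder_prob (Suc r) n = prob (\<Union>j\<in>{..n}. ?E j)" by (simp add: ladder_prob_def)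
  also have "\<dots> = (\<Sum>j\<le>n. prob (?E j))"
    using E ladder_unique[of r] by (intro finite_measure_finite_Union) (simp, blast, auto simp: disjoint_family_on_def)
  also have "\<dots> = (\<Sum>j\<le>n. ladder_prob r j * ladder_prob 1 (n - j))"
    by (intro sum.cong refl prob_ladder_then) simp
  finally show ?thesis .
qed

lemma prob_rec_count_ge:
  "\<P>(\<omega> in M. r \<le> rec_count (\<lambda>i. X i \<omega>) n) = (\<Sum>m\<le>n. ladder_prob r m)"
proof -
  have "{\<omega> \<in> space M. r \<le> rec_count (\<lambda>i. X i \<omega>) n} = (\<Union>m\<in>{..n}. {\<omega> \<in> space M. ladder r m (\<lambda>i. X i \<omega>)})"
    by (auto simp: rec_count_ge_iff)
  also have "prob \<dots> = (\<Sum>m\<le>n. ladder_prob r m)"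
    unfolding ladder_prob_def
    by (intro finite_measure_finite_Union)
       (use ladder_event[of r _ "\<lambda>i. i"] ladder_unique in \<open>fastforce simp: disjoint_family_on_def\<close>)+
  finally show ?thesis by simp
qed

lemma sum_ladder_prob_le_1: "(\<Sum>m\<le>n. ladder_prob r m) \<le> 1"
  unfolding prob_rec_count_ge[symmetric] by simp

text \<open>Expectation of \<open>cyclic_ladder_sum\<close>: each rotation has the law of the
  original steps, so the sum over rotations becomes a factor \<open>n\<close>.\<close>

lemma prob_psum_nonneg:
  assumes n: "n \<ge> 1"
  shows "\<P>(\<omega> in M. psum (\<lambda>i. X i \<omega>) n \<ge> 0) / real n = (\<Sum>r\<in>{1..n}. ladder_prob r n / real r)"
proof -
  let ?f = "\<lambda>\<nu> i. (\<nu> + i) mod n"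
  have inj: "inj_on (?f \<nu>) {..<n}" for \<nu>
  proof (rule linorder_inj_onI)
    fix i k assume a: "i < k" "i \<in> {..<n}" "k \<in> {..<n}"
    then have "\<not> n dvd (\<nu> + k) - (\<nu> + i)" by (simp add: nat_dvd_not_less)
    then show "?f \<nu> i \<noteq> ?f \<nu> k" using a mod_eq_dvd_iff_nat[of "\<nu> + i" "\<nu> + k" n] by auto
  qed auto
  have I: "{\<omega> \<in> space M. psum (\<lambda>i. X i \<omega>) n \<ge> 0} \<in> sets M" unfolding psum_def by measurable
  have int: "integrable M (\<lambda>\<omega>. indicat_real {\<omega> \<in> space M. ladder r n (\<lambda>i. X (?f \<nu> i) \<omega>)} \<omega> / real r)" for r \<nu>
    using ladder_event[of r n "?f \<nu>"]
    by (intro integrable_divide integrable_real_indicator) (auto simp: emeasure_eq_measure)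
  have "(\<Sum>\<nu><n. \<Sum>r\<in>{1..n}. expectation (indicator {\<omega> \<in> space M. ladder r n (\<lambda>i. X (?f \<nu> i) \<omega>)}) / real r)
      = expectation (\<lambda>\<omega>. \<Sum>\<nu><n. \<Sum>r\<in>{1..n}. indicator {\<omega> \<in> space M. ladder r n (\<lambda>i. X (?f \<nu> i) \<omega>)} \<omega> / real r)"
    using int by (simp add: Bochner_Integration.integral_sum)
  also have "\<dots> = expectation (indicator {\<omega> \<in> space M. psum (\<lambda>i. X i \<omega>) n \<ge> 0})"
  proof (rule Bochner_Integration.integral_cong[OF refl])
    fix \<omega> assume "\<omega> \<in> space M"
    then show "(\<Sum>\<nu><n. \<Sum>r\<in>{1..n}. indicator {\<omega> \<in> space M. ladder r n (\<lambda>i. X (?f \<nu> i) \<omega>)} \<omega> / real r)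
        = (indicator {\<omega> \<in> space M. psum (\<lambda>i. X i \<omega>) n \<ge> 0} \<omega> :: real)"
      using cyclic_ladder_sum[OF n, of "\<lambda>i. X i \<omega>"] by (simp add: indicator_def)
  qed
  finally have "(\<Sum>\<nu><n. \<Sum>r\<in>{1..n}. ladder_prob r n / real r) = \<P>(\<omega> in M. psum (\<lambda>i. X i \<omega>) n \<ge> 0)"
    using I by (simp add: ladder_event prob_ladder_inj[OF inj] Int_absorb2 Collect_subset)
  then show ?thesis using n by (simp add: field_simps)
qed

section \<open>Generating functions of the ladder epochs\<close>

definition ladder_gf :: "real \<Rightarrow> real" where "ladder_gf s = (\<Sum>n. ladder_prob 1 n * s ^ n)"

lemma summable_ladder_prob: "0 \<le> s \<Longrightarrow> s < 1 \<Longrightarrow> summable (\<lambda>n. ladder_prob r n * s ^ n)"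
  by (rule summable_comparison_test'[OF summable_geometric[of s], of 0])
     (auto simp: ladder_prob_nonneg ladder_prob_le_1 abs_mult intro: mult_left_le_one_le)

lemma ladder_gf_nonneg: "0 \<le> s \<Longrightarrow> s < 1 \<Longrightarrow> 0 \<le> ladder_gf s"
  unfolding ladder_gf_def by (intro suminf_nonneg summable_ladder_prob) (auto simp: ladder_prob_nonneg)

text \<open>The first epoch is at least 1, and \<open>s ^ n \<le> s\<close> from there on. The bound
  keeps \<open>ladder_gf s\<close> below 1, as the logarithm of \<open>1 - ladder_gf s\<close>
  demands.\<close>

lemma ladder_gf_le: assumes "0 \<le> s" "s < 1" shows "ladder_gf s \<le> s"
  unfolding ladder_gf_def
proof (rule suminf_le_const[OF summable_ladder_prob[OF assms]])
  fix N
  have "(\<Sum>n<N. ladder_prob 1 n * s ^ n) \<le> (\<Sum>n<N. ladder_prob 1 n * s)"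
  proof (rule sum_mono)
    fix n assume "n \<in> {..<N}"
    show "ladder_prob 1 n * s ^ n \<le> ladder_prob 1 n * s"
    proof (cases n)
      case 0
      then show ?thesis by (simp add: ladder_prob_at_0)
    next
      case (Suc k)
      have "s ^ Suc k \<le> s" using assms power_decreasing[of 1 "Suc k" s] by simp
      then show ?thesis unfolding Suc by (intro mult_left_mono ladder_prob_nonneg)
    qed
  qed
  also have "\<dots> = (\<Sum>n<N. ladder_prob 1 n) * s" by (simp add: sum_distrib_right)
  also have "\<dots> \<le> (\<Sum>n\<le>N. ladder_prob 1 n) * s"
    using assms by (intro mult_right_mono sum_mono2) (auto simp: ladder_prob_nonneg)
  also have "\<dots> \<le> s" using mult_right_mono[OF sum_ladder_prob_le_1[of 1 N], of s] assms by simp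
  finally show "(\<Sum>n<N. ladder_prob 1 n * s ^ n) \<le> s" .
qed

text \<open>The renewal equation is a convolution, which becomes a Cauchy product of power
  series.\<close>

lemma ladder_prob_sums_power:
  assumes "0 \<le> s" "s < 1"
  shows "(\<lambda>n. ladder_prob r n * s ^ n) sums (ladder_gf s ^ r)"
proof (induction r)
  case 0
  show ?case using sums_single[of 0 "\<lambda>n. s ^ n"] by (auto simp: ladder_prob_0 of_bool_def elim!: sums_cong[THEN iffD1, rotated])
next
  case (Suc r)
  have "(\<lambda>k. \<Sum>i\<le>k. (ladder_prob r i * s ^ i) * (ladder_prob 1 (k - i) * s ^ (k - i)))
      sums ((\<Sum>k. ladder_prob r k * s ^ k) * (\<Sum>k. ladder_prob 1 k * s ^ k))"
    using summable_ladder_prob[OF assms] assms by (intro Cauchy_product_sums) (auto simp: abs_mult ladder_prob_nonneg)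
  also have "(\<Sum>k. ladder_prob r k * s ^ k) * (\<Sum>k. ladder_prob 1 k * s ^ k) = ladder_gf s ^ Suc r"
    using sums_unique[OF Suc.IH] by (simp add: ladder_gf_def)
  also have "(\<lambda>k. \<Sum>i\<le>k. (ladder_prob r i * s ^ i) * (ladder_prob 1 (k - i) * s ^ (k - i))) = (\<lambda>n. ladder_prob (Suc r) n * s ^ n)"
  proof
    fix k
    have "(ladder_prob r i * s ^ i) * (ladder_prob 1 (k - i) * s ^ (k - i)) = ladder_prob r i * ladder_prob 1 (k - i) * s ^ k" if "i \<le> k" for i
      using that by (simp add: power_add[symmetric])
    then show "(\<Sum>i\<le>k. (ladder_prob r i * s ^ i) * (ladder_prob 1 (k - i) * s ^ (k - i))) = ladder_prob (Suc r) k * s ^ k"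
      unfolding ladder_prob_Suc[of r k] sum_distrib_right by (intro sum.cong refl) simp
  qed
  finally show ?case .
qed

text \<open>Sum the nonnegative array \<open>P(T_r = n) * s ^ n / r\<close> in both orders. Rows
  give powers of \<open>ladder_gf s\<close> and then the logarithmic series; columns give
  \<open>P(S_n \<ge> 0) * s ^ n / n\<close> by the cyclic identity.\<close>

lemma baxter_identity:
  assumes s: "0 \<le> s" "s < 1"
  shows "(\<lambda>n. s ^ Suc n / real (Suc n) * \<P>(\<omega> in M. psum (\<lambda>i. X i \<omega>) (Suc n) \<ge> 0)) sums (- ln (1 - ladder_gf s))"
proof -
  define h where "h = (\<lambda>(r, n). ladder_prob (Suc r) n * s ^ n / real (Suc r))"
  have h0: "h z \<ge> 0" for z using s by (auto simp: h_def ladder_prob_nonneg split: prod.splits)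
  have gf: "0 \<le> ladder_gf s" "ladder_gf s < 1" using ladder_gf_nonneg[OF s] ladder_gf_le[OF s] s by auto
  have rows: "((\<lambda>n. h (r, n)) has_sum (ladder_gf s ^ Suc r / real (Suc r))) UNIV" for r
    using sums_divide[OF ladder_prob_sums_power[OF s, of "Suc r"], of "real (Suc r)"] h0[of "(r, _)"]
    by (intro sums_nonneg_imp_has_sum) (auto simp: h_def)
  have outer: "((\<lambda>n. ladder_gf s ^ Suc n / real (Suc n)) has_sum (- ln (1 - ladder_gf s))) UNIV"
    using gf by (intro sums_nonneg_imp_has_sum ln_one_minus_sums) auto
  have "h summable_on (UNIV \<times> UNIV)"
    by (rule summable_on_SigmaI[where g = "\<lambda>r. ladder_gf s ^ Suc r / real (Suc r)"])
       (use rows outer h0 in \<open>auto simp: summable_on_def\<close>)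
  then have "(h has_sum (- ln (1 - ladder_gf s))) (UNIV \<times> UNIV)"
    by (intro has_sum_SigmaI[where g = "\<lambda>r. ladder_gf s ^ Suc r / real (Suc r)"] rows outer) auto
  then have sw: "((\<lambda>(n, r). h (r, n)) has_sum (- ln (1 - ladder_gf s))) (UNIV \<times> UNIV)"
    by (subst (asm) has_sum_swap)
  let ?c = "\<lambda>n. (\<Sum>r\<in>{1..n}. ladder_prob r n / real r) * s ^ n"
  have cols: "((\<lambda>r. h (r, n)) has_sum ?c n) UNIV" for n
  proof -
    have "(\<Sum>r<n. h (r, n)) = ?c n"
      unfolding h_def sum_distrib_right
      by (rule sum.reindex_bij_witness[of _ "\<lambda>r. r - 1" Suc]) auto
    moreover have "((\<lambda>r. h (r, n)) has_sum (\<Sum>r<n. h (r, n))) {..<n}"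
      by (rule has_sum_finite) simp
    ultimately have "((\<lambda>r. h (r, n)) has_sum ?c n) {..<n}" by simp
    \<comment> \<open>\<open>h (r, n)\<close> carries the epoch index \<open>Suc r\<close>, which
      exceeds \<open>n\<close> as soon as \<open>r\<close> leaves \<open>{..<n}\<close>.\<close>
    then show ?thesis
      by (rule has_sum_cong_neutral[THEN iffD1, rotated -1]) (auto simp: h_def ladder_prob_eq_0)
  qed
  have "(?c has_sum (- ln (1 - ladder_gf s))) UNIV"
    by (rule has_sum_SigmaD[OF sw]) (use cols in auto)
  then have "?c sums (- ln (1 - ladder_gf s))" by (rule has_sum_imp_sums)
  then have "(\<lambda>n. ?c (Suc n)) sums (- ln (1 - ladder_gf s))" by (subst sums_Suc_iff) simp
  moreover have "?c (Suc n) = s ^ Suc n / real (Suc n) * \<P>(\<omega> in M. psum (\<lambda>i. X i \<omega>) (Suc n) \<ge> 0)" for n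
    by (subst prob_psum_nonneg[symmetric]) simp_all
  ultimately show ?thesis by simp
qed

end

section \<open>Translation to \<open>num_records\<close> and \<open>C_fun\<close>\<close>

lemma psum_eq_walk: "psum (\<lambda>i. X i \<omega>) n = walk X n \<omega>"
  by (simp add: psum_def walk_def)

lemma is_rec_eq_weak_record: "is_rec (\<lambda>i. X i \<omega>) n \<longleftrightarrow> weak_record X n \<omega>"
  unfolding weak_record_def is_rec_def psum_eq_walk by (subst eq_Max_iff) auto

lemma num_records_eq: "num_records X n \<omega> = Suc (rec_count (\<lambda>i. X i \<omega>) n)"
proof -
  have "{m \<in> {0..n}. weak_record X m \<omega>} = insert 0 {m \<in> {1..n}. is_rec (\<lambda>i. X i \<omega>) m}"
    using is_rec_0[of "\<lambda>i. X i \<omega>"] by (auto simp: is_rec_eq_weak_record Suc_le_eq)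
  then show ?thesis by (simp add: num_records_def rec_count_def)
qed

context iid_steps
begin

lemma prob_nonneg_bounds: "0 \<le> prob_nonneg M X k" "prob_nonneg M X k \<le> 1"
  by (auto simp: prob_nonneg_def)

lemma abs_prob_nonneg_le: "\<bar>prob_nonneg M X k\<bar> \<le> 1"
  using prob_nonneg_bounds[of k] by simp

lemma ladder_gf_eq:
  assumes "0 \<le> s" "s < 1"
  shows "ladder_gf s = 1 - exp (- log_series (prob_nonneg M X) s)"
proof -
  have "log_series (prob_nonneg M X) s = - ln (1 - ladder_gf s)"
    using sums_unique[OF baxter_identity[OF assms]]
    by (simp add: log_series_def prob_nonneg_def psum_eq_walk)
  moreover have "ladder_gf s < 1" using ladder_gf_le[OF assms] assms by simp
  ultimately show ?thesis by simp
qed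

text \<open>Centring by \<rho> adds \<open>\<rho> * ln (1 - s)\<close> to the exponent. Together
  with \<open>ladder_gf_eq\<close>, \<open>C_fun\<close> becomes
  \<open>(1 - s) powr \<rho> / (1 - ladder_gf s)\<close>.\<close>

lemma C_fun_eq:
  assumes "0 \<le> s" "s < 1"
  shows "C_fun M X \<rho> s = exp (log_series (prob_nonneg M X) s) * (1 - s) powr \<rho>"
proof -
  have "C_fun M X \<rho> s = exp (log_series (\<lambda>k. prob_nonneg M X k - \<rho>) s)"
    by (simp add: C_fun_def log_series_def)
  also have "\<dots> = exp (log_series (prob_nonneg M X) s + \<rho> * ln (1 - s))"
    using log_series_shift[where c = "prob_nonneg M X" and B = 1] abs_prob_nonneg_le assms by simp
  finally show ?thesis using assms by (simp add: exp_add powr_def)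
qed

end

subsection \<open>Large deviations by exponential tilting\<close>

text \<open>Comparison on the scale \<open>exp (b n)\<close>: a strict gap between exponential rates
  absorbs any constant. The constant is 3 because two such terms will be removed from a sum of
  three.\<close>

lemma eventually_exp_mult_le_third:
  fixes A D b :: "nat \<Rightarrow> real"
  assumes b: "filterlim b at_top sequentially"
    and A: "(\<lambda>n. ln (A n) / b n) \<longlonglongrightarrow> x" "\<forall>\<^sub>F n in sequentially. A n > 0"
    and D: "(\<lambda>n. ln (D n) / b n) \<longlonglongrightarrow> z" "\<forall>\<^sub>F n in sequentially. D n > 0"
    and t: "t + x < z"
  shows "\<forall>\<^sub>F n in sequentially. exp (t * b n) * A n \<le> D n / 3"
proof -
  have "(\<lambda>n. t + ln (A n) / b n - ln (D n) / b n + ln 3 / b n) \<longlonglongrightarrow> t + x - z + 0"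
    by (intro tendsto_intros A(1) D(1) real_tendsto_divide_at_top[OF tendsto_const b])
  then have "\<forall>\<^sub>F n in sequentially. t + ln (A n) / b n - ln (D n) / b n + ln 3 / b n < 0"
    using t by (intro order_tendstoD(2)) auto
  moreover have "\<forall>\<^sub>F n in sequentially. b n > 0"
    using b by (auto simp: filterlim_at_top_dense)
  ultimately show ?thesis using A(2) D(2)
  proof eventually_elim
    case (elim n)
    from mult_neg_pos[OF elim(1,2)] have "t * b n + ln (A n) + ln 3 < ln (D n)"
      using elim(2) by (simp add: ring_distribs)
    then have "exp (t * b n + ln (A n) + ln 3) \<le> exp (ln (D n))" by simp
    then show ?case using elim by (simp add: exp_add)
  qed
qed

text \<open>In the application \<open>w n\<close> is the law of the epoch with index
  \<open>r n\<close> and \<open>G n\<close> its generating function. \<open>G_lim\<close> then says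
  that the epoch divided by \<open>n\<close> has limiting log-Laplace transform \<open>- g\<close>
  at speed \<open>b n\<close>. No smoothness of \<open>g\<close> enters, and \<open>g\<close> may be
  constant.\<close>

locale exponential_tilting =
  fixes w :: "nat \<Rightarrow> nat \<Rightarrow> real" and G :: "nat \<Rightarrow> real \<Rightarrow> real" and b :: "nat \<Rightarrow> real" and g :: "real \<Rightarrow> real"
  assumes w_nonneg: "0 \<le> w n m"
    and w_sums: "0 < s \<Longrightarrow> s < 1 \<Longrightarrow> (\<lambda>m. w n m * s ^ m) sums G n s"
    and b_at_top: "filterlim b at_top sequentially"
    and G_lim: "\<theta> > 0 \<Longrightarrow> (\<lambda>n. ln (G n (exp (- \<theta> * b n / real n))) / b n) \<longlonglongrightarrow> - g \<theta>"
    and g_pos: "\<theta> > 0 \<Longrightarrow> g \<theta> > 0"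
begin

abbreviation (input) tilt :: "real \<Rightarrow> nat \<Rightarrow> real" where
  "tilt \<theta> n \<equiv> exp (- \<theta> * b n / real n)"

lemma b_pos: "\<forall>\<^sub>F n in sequentially. b n > 0"
  using b_at_top by (auto simp: filterlim_at_top_dense)

lemma G_nonneg: "0 < s \<Longrightarrow> s < 1 \<Longrightarrow> 0 \<le> G n s"
  by (rule sums_le[OF _ sums_zero w_sums]) (auto simp: w_nonneg)

lemma tilt_bounds: "b n > 0 \<Longrightarrow> n > 0 \<Longrightarrow> \<theta> > 0 \<Longrightarrow> 0 < tilt \<theta> n \<and> tilt \<theta> n < 1"
  by (simp add: divide_neg_pos)

text \<open>If the generating function vanished, the convention \<open>ln 0 = 0\<close> would contradict the limit.\<close>

lemma G_pos:
  assumes "\<theta> > 0" shows "\<forall>\<^sub>F n in sequentially. G n (tilt \<theta> n) > 0"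
proof -
  have "\<forall>\<^sub>F n in sequentially. ln (G n (tilt \<theta> n)) / b n < 0"
    using G_lim[OF assms] g_pos[OF assms] by (intro order_tendstoD(2)) auto
  then show ?thesis using b_pos eventually_gt_at_top[of 0]
  proof eventually_elim
    case (elim n)
    then have "G n (tilt \<theta> n) \<noteq> 0" by auto
    moreover have "0 \<le> G n (tilt \<theta> n)" using tilt_bounds[of n \<theta>] elim assms by (intro G_nonneg) auto
    ultimately show ?case by simp
  qed
qed

lemma tilt_power: "tilt \<theta> n ^ m = exp (- \<theta> * b n * (real m / real n))"
  by (simp add: exp_of_nat_mult[symmetric] mult_ac)

text \<open>Chernoff bound: \<open>exp (\<theta> * b n) * tilt \<theta> n ^ m\<close> is at least 1
  for \<open>m \<le> n\<close>.\<close>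

lemma upper_bound:
  assumes "n > 0" "b n > 0" "\<theta> > 0"
  shows "(\<Sum>m\<le>n. w n m) \<le> exp (\<theta> * b n) * G n (tilt \<theta> n)"
proof -
  have "(\<Sum>m\<le>n. w n m) \<le> (\<Sum>m\<le>n. exp (\<theta> * b n) * (w n m * tilt \<theta> n ^ m))"
  proof (rule sum_mono)
    fix m assume "m \<in> {..n}"
    then have "real m / real n \<le> 1" using assms by simp
    then have "\<theta> * b n * (real m / real n) \<le> \<theta> * b n * 1"
      using assms by (intro mult_left_mono) auto
    then have "1 \<le> exp (\<theta> * b n) * tilt \<theta> n ^ m"
      unfolding tilt_power exp_add[symmetric] by simp
    from mult_left_mono[OF this w_nonneg[of n m]]
    show "w n m \<le> exp (\<theta> * b n) * (w n m * tilt \<theta> n ^ m)" by (simp add: mult_ac)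
  qed
  also have "\<dots> = exp (\<theta> * b n) * (\<Sum>m\<le>n. w n m * tilt \<theta> n ^ m)" by (simp add: sum_distrib_left)
  also have "(\<Sum>m\<le>n. w n m * tilt \<theta> n ^ m) \<le> G n (tilt \<theta> n)"
    using w_sums[of "tilt \<theta> n" n] tilt_bounds[OF assms(2,1,3)] w_nonneg
    by (subst sums_unique[of _ "G n (tilt \<theta> n)"]) (auto intro!: sum_le_suminf simp: sums_iff)
  finally show ?thesis by simp
qed

text \<open>Under the law tilted by \<open>\<theta>\<close> the mass concentrates on \<open>\<alpha> n \<le> m \<le> n\<close>: the part \<open>m > n\<close> is
  controlled by tilting less, the part \<open>m < \<alpha> n\<close> by tilting more.\<close>

lemma lower_bound:
  assumes th: "0 < \<theta>'" "\<theta>' < \<theta>" "g \<theta> - g \<theta>' < \<theta> - \<theta>'"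
    and al: "\<theta> < \<theta>''" "\<alpha> = 0 \<or> \<alpha> * (\<theta>'' - \<theta>) < g \<theta>'' - g \<theta>" "\<alpha> \<ge> 0"
  shows "\<forall>\<^sub>F n in sequentially. exp (\<theta> * \<alpha> * b n) * G n (tilt \<theta> n) / 3 \<le> (\<Sum>m\<le>n. w n m)"
proof -
  have pos: "0 < \<theta>" "0 < \<theta>''" using th al by auto
  have 1: "\<forall>\<^sub>F n in sequentially. exp (- (\<theta> - \<theta>') * b n) * G n (tilt \<theta>' n) \<le> G n (tilt \<theta> n) / 3"
    by (rule eventually_exp_mult_le_third[OF b_at_top G_lim G_pos G_lim G_pos]) (use th pos in auto)
  \<comment> \<open>For \<open>\<alpha> = 0\<close> there is no \<open>m < \<alpha> n\<close> to
    control, so the factor is set to 0. This admits a constant \<open>g\<close>.\<close>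
  define \<kappa> where "\<kappa> = (\<lambda>n. if \<alpha> = 0 then 0 else exp (\<alpha> * (\<theta>'' - \<theta>) * b n))"
  have 2: "\<forall>\<^sub>F n in sequentially. \<kappa> n * G n (tilt \<theta>'' n) \<le> G n (tilt \<theta> n) / 3"
  proof (cases "\<alpha> = 0")
    case True
    show ?thesis using G_pos[OF pos(1)] by eventually_elim (simp add: \<kappa>_def True)
  next
    case False
    then have "\<forall>\<^sub>F n in sequentially. exp (\<alpha> * (\<theta>'' - \<theta>) * b n) * G n (tilt \<theta>'' n) \<le> G n (tilt \<theta> n) / 3"
      by (intro eventually_exp_mult_le_third[OF b_at_top G_lim G_pos G_lim G_pos]) (use al pos in auto)
    then show ?thesis using False by (simp add: \<kappa>_def)
  qed
  show ?thesis using 1 2 b_pos eventually_gt_at_top[of 0]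
  proof eventually_elim
    case (elim n)
    note b = \<open>b n > 0\<close> and n = \<open>n > 0\<close>
    \<comment> \<open>The three summands serve, in this order, for
      \<open>\<alpha> n \<le> m \<le> n\<close>, for \<open>m > n\<close> and for
      \<open>m < \<alpha> n\<close>.\<close>
    let ?h = "\<lambda>m. (if m \<in> {..n} then w n m * exp (- \<theta> * \<alpha> * b n) else 0)
        + exp (- (\<theta> - \<theta>') * b n) * (w n m * tilt \<theta>' n ^ m) + \<kappa> n * (w n m * tilt \<theta>'' n ^ m)"
    have \<kappa>0: "\<kappa> n \<ge> 0" by (simp add: \<kappa>_def)
    have le: "w n m * tilt \<theta> n ^ m \<le> ?h m" for m
    proof -
      have nn: "0 \<le> w n m * exp (- \<theta> * \<alpha> * b n)"
        "0 \<le> exp (- (\<theta> - \<theta>') * b n) * (w n m * tilt \<theta>' n ^ m)" "0 \<le> \<kappa> n * (w n m * tilt \<theta>'' n ^ m)"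
        using w_nonneg \<kappa>0 by auto
      consider "m > n" | "m \<le> n" "\<alpha> * real n \<le> real m" | "real m < \<alpha> * real n" by linarith
      then show ?thesis
      proof cases
        case 1
        then have "1 \<le> real m / real n" using n by simp
        then have "(\<theta> - \<theta>') * b n * 1 \<le> (\<theta> - \<theta>') * b n * (real m / real n)"
          using th b by (intro mult_left_mono) auto
        then have "tilt \<theta> n ^ m \<le> exp (- (\<theta> - \<theta>') * b n) * tilt \<theta>' n ^ m"
          unfolding tilt_power exp_add[symmetric] by (simp add: algebra_simps)
        from mult_left_mono[OF this w_nonneg[of n m]] show ?thesis using nn by (auto simp: mult_ac)
      next
        case 2
        then have "\<alpha> \<le> real m / real n" using n by (simp add: field_simps)
        then have "\<theta> * b n * \<alpha> \<le> \<theta> * b n * (real m / real n)"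
          using pos b by (intro mult_left_mono) auto
        then have "tilt \<theta> n ^ m \<le> exp (- \<theta> * \<alpha> * b n)"
          unfolding tilt_power by (simp add: algebra_simps)
        from mult_left_mono[OF this w_nonneg[of n m]] show ?thesis using nn 2 by auto
      next
        case 3
        then have "\<alpha> \<noteq> 0" by auto
        have "real m / real n \<le> \<alpha>" using 3 n by (simp add: field_simps)
        then have "(\<theta>'' - \<theta>) * b n * (real m / real n) \<le> (\<theta>'' - \<theta>) * b n * \<alpha>"
          using al b by (intro mult_left_mono) auto
        then have "tilt \<theta> n ^ m \<le> \<kappa> n * tilt \<theta>'' n ^ m"
          using \<open>\<alpha> \<noteq> 0\<close> unfolding tilt_power \<kappa>_def by (simp add: exp_add[symmetric] algebra_simps)
        from mult_left_mono[OF this w_nonneg[of n m]] show ?thesis using nn by (auto simp: mult_ac)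
      qed
    qed
    have "?h sums ((\<Sum>m\<in>{..n}. w n m * exp (- \<theta> * \<alpha> * b n))
        + exp (- (\<theta> - \<theta>') * b n) * G n (tilt \<theta>' n) + \<kappa> n * G n (tilt \<theta>'' n))"
      using tilt_bounds[OF b n] th pos
      by (intro sums_add sums_mult sums_If_finite_set w_sums) auto
    then have "G n (tilt \<theta> n) \<le> (\<Sum>m\<in>{..n}. w n m * exp (- \<theta> * \<alpha> * b n))
        + exp (- (\<theta> - \<theta>') * b n) * G n (tilt \<theta>' n) + \<kappa> n * G n (tilt \<theta>'' n)"
      using tilt_bounds[OF b n pos(1)] le by (intro sums_le[OF _ w_sums]) auto
    \<comment> \<open>The two outer parts take at most a third of
      \<open>G n (tilt \<theta> n)\<close> each, so a third is left for the middle part.\<close>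
    then have "G n (tilt \<theta> n) / 3 \<le> (\<Sum>m\<le>n. w n m) * exp (- \<theta> * \<alpha> * b n)"
      unfolding sum_distrib_right using elim(1,2) by linarith
    then have "exp (\<theta> * \<alpha> * b n) * (G n (tilt \<theta> n) / 3) \<le> exp (\<theta> * \<alpha> * b n) * ((\<Sum>m\<le>n. w n m) * exp (- \<theta> * \<alpha> * b n))"
      by (rule mult_left_mono) simp
    also have "\<dots> = (\<Sum>m\<le>n. w n m)" by (simp add: exp_minus)
    finally show ?case by simp
  qed
qed

text \<open>The value \<open>v\<close> is approached from above by the exponents
  \<open>\<theta> - g \<theta>\<close> of the Chernoff bound and from below by the exponents
  \<open>\<theta> * \<alpha> - g \<theta>\<close> of the tilted lower bound.\<close>

lemma log_prob_limit:
  assumes upper: "\<And>e. e > 0 \<Longrightarrow> \<exists>\<theta>>0. \<theta> - g \<theta> < v + e"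
    and lower: "\<And>e. e > 0 \<Longrightarrow> \<exists>\<theta>' \<theta> \<theta>'' \<alpha>. 0 < \<theta>' \<and> \<theta>' < \<theta> \<and> g \<theta> - g \<theta>' < \<theta> - \<theta>' \<and>
        \<theta> < \<theta>'' \<and> (\<alpha> = 0 \<or> \<alpha> * (\<theta>'' - \<theta>) < g \<theta>'' - g \<theta>) \<and> \<alpha> \<ge> 0 \<and> v - e < \<theta> * \<alpha> - g \<theta>"
  shows "(\<lambda>n. ln (\<Sum>m\<le>n. w n m) / b n) \<longlonglongrightarrow> v"
proof (rule order_tendstoI)
  have low: "\<forall>\<^sub>F n in sequentially. (\<Sum>m\<le>n. w n m) > 0 \<and> v - e < ln (\<Sum>m\<le>n. w n m) / b n" if e: "e > 0" for e
  proof -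
    obtain \<theta>' \<theta> \<theta>'' \<alpha> where p: "0 < \<theta>'" "\<theta>' < \<theta>" "g \<theta> - g \<theta>' < \<theta> - \<theta>'" "\<theta> < \<theta>''"
        "\<alpha> = 0 \<or> \<alpha> * (\<theta>'' - \<theta>) < g \<theta>'' - g \<theta>" "\<alpha> \<ge> 0" "v - e < \<theta> * \<alpha> - g \<theta>"
      using lower[OF e] by blast
    have th: "\<theta> > 0" using p by simp
    have "(\<lambda>n. \<theta> * \<alpha> + ln (G n (tilt \<theta> n)) / b n - ln 3 / b n) \<longlonglongrightarrow> \<theta> * \<alpha> + (- g \<theta>) - 0"
      by (intro tendsto_intros G_lim th real_tendsto_divide_at_top[OF tendsto_const b_at_top])
    then have "\<forall>\<^sub>F n in sequentially. v - e < \<theta> * \<alpha> + ln (G n (tilt \<theta> n)) / b n - ln 3 / b n"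
      using p by (intro order_tendstoD(1)) auto
    then show ?thesis using lower_bound[OF p(1-6)] G_pos[OF th] b_pos
    proof eventually_elim
      case (elim n)
      have "0 < exp (\<theta> * \<alpha> * b n) * G n (tilt \<theta> n) / 3" using elim by simp
      moreover from this have "0 < (\<Sum>m\<le>n. w n m)" using elim(2) by linarith
      ultimately have "ln (exp (\<theta> * \<alpha> * b n) * G n (tilt \<theta> n) / 3) \<le> ln (\<Sum>m\<le>n. w n m)"
        using elim(2) by (subst ln_le_cancel_iff) auto
      then have "\<theta> * \<alpha> * b n + ln (G n (tilt \<theta> n)) - ln 3 \<le> ln (\<Sum>m\<le>n. w n m)"
        using elim by (simp add: ln_mult ln_div)
      then have "(\<theta> * \<alpha> * b n + ln (G n (tilt \<theta> n)) - ln 3) / b n \<le> ln (\<Sum>m\<le>n. w n m) / b n"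
        using elim by (intro divide_right_mono) auto
      then have "\<theta> * \<alpha> + ln (G n (tilt \<theta> n)) / b n - ln 3 / b n \<le> ln (\<Sum>m\<le>n. w n m) / b n"
        using elim by (simp add: add_divide_distrib diff_divide_distrib)
      then show ?case using elim \<open>0 < (\<Sum>m\<le>n. w n m)\<close> by linarith
    qed
  qed
  fix c assume "c < v"
  then show "\<forall>\<^sub>F n in sequentially. c < ln (\<Sum>m\<le>n. w n m) / b n"
    using low[of "v - c"] by (auto elim: eventually_mono)
next
  fix c assume "v < c"
  then obtain \<theta> where th: "\<theta> > 0" "\<theta> - g \<theta> < c" using upper[of "c - v"] by auto
  \<comment> \<open>Since \<open>ln 0 = 0\<close>, the upper estimate of the logarithm also needs a
    positive probability, which the lower bound provides.\<close>
  have "\<forall>\<^sub>F n in sequentially. (\<Sum>m\<le>n. w n m) > 0"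
  proof -
    obtain \<theta>' \<theta> \<theta>'' \<alpha> where p: "0 < \<theta>'" "\<theta>' < \<theta>" "g \<theta> - g \<theta>' < \<theta> - \<theta>'" "\<theta> < \<theta>''"
        "\<alpha> = 0 \<or> \<alpha> * (\<theta>'' - \<theta>) < g \<theta>'' - g \<theta>" "\<alpha> \<ge> 0" "v - 1 < \<theta> * \<alpha> - g \<theta>"
      using lower[of 1] by auto
    have "\<theta> > 0" using p by simp
    show ?thesis using lower_bound[OF p(1-6)] G_pos[OF \<open>\<theta> > 0\<close>]
    proof eventually_elim
      case (elim n)
      have "0 < exp (\<theta> * \<alpha> * b n) * G n (tilt \<theta> n) / 3" using elim by simp
      then show ?case using elim(1) by linarith
    qed
  qed
  moreover have "(\<lambda>n. \<theta> + ln (G n (tilt \<theta> n)) / b n) \<longlonglongrightarrow> \<theta> + (- g \<theta>)"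
    by (intro tendsto_intros G_lim th)
  then have "\<forall>\<^sub>F n in sequentially. \<theta> + ln (G n (tilt \<theta> n)) / b n < c"
    using th by (intro order_tendstoD(2)) auto
  ultimately show "\<forall>\<^sub>F n in sequentially. ln (\<Sum>m\<le>n. w n m) / b n < c"
    using G_pos[OF th(1)] b_pos eventually_gt_at_top[of 0]
  proof eventually_elim
    case (elim n)
    have "ln (\<Sum>m\<le>n. w n m) \<le> ln (exp (\<theta> * b n) * G n (tilt \<theta> n))"
      using upper_bound[of n \<theta>] elim th by (subst ln_le_cancel_iff) auto
    also have "\<dots> = \<theta> * b n + ln (G n (tilt \<theta> n))" using elim by (simp add: ln_mult)
    finally have "ln (\<Sum>m\<le>n. w n m) / b n \<le> (\<theta> * b n + ln (G n (tilt \<theta> n))) / b n"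
      using elim by (intro divide_right_mono) auto
    also have "\<dots> = \<theta> + ln (G n (tilt \<theta> n)) / b n" using elim by (simp add: add_divide_distrib)
    finally have "ln (\<Sum>m\<le>n. w n m) / b n \<le> \<theta> + ln (G n (tilt \<theta> n)) / b n" .
    then show ?case using elim by linarith
  qed
qed

end

text \<open>For \<open>\<rho> > 0\<close> the function \<open>\<theta> - g \<theta>\<close> has its
  minimum at a point \<open>c\<close> where \<open>g\<close> has slope 1. Tilting slightly beyond
  \<open>c\<close>, with \<alpha> slightly below the slope there, comes close to the value from
  below. For \<open>\<rho> = 0\<close> the infimum \<open>- y\<close> is approached as \<theta>
  tends to 0 and is not attained.\<close>

lemma legendre_value:
  fixes \<rho> y :: real
  assumes "0 \<le> \<rho>" "\<rho> < 1" "y > 0"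
  defines "v \<equiv> - (1 - \<rho>) * (rpow \<rho> \<rho> * y) powr (1 / (1 - \<rho>))"
    and "g \<equiv> \<lambda>\<theta>. y * \<theta> powr \<rho>"
  shows "\<And>e. e > 0 \<Longrightarrow> \<exists>\<theta>>0. \<theta> - g \<theta> < v + e"
    and "\<And>e. e > 0 \<Longrightarrow> \<exists>\<theta>' \<theta> \<theta>'' \<alpha>. 0 < \<theta>' \<and> \<theta>' < \<theta> \<and> g \<theta> - g \<theta>' < \<theta> - \<theta>' \<and>
        \<theta> < \<theta>'' \<and> (\<alpha> = 0 \<or> \<alpha> * (\<theta>'' - \<theta>) < g \<theta>'' - g \<theta>) \<and> \<alpha> \<ge> 0 \<and> v - e < \<theta> * \<alpha> - g \<theta>"
proof -
  have "(\<forall>e>0. \<exists>\<theta>>0. \<theta> - g \<theta> < v + e) \<and>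
    (\<forall>e>0. \<exists>\<theta>' \<theta> \<theta>'' \<alpha>. 0 < \<theta>' \<and> \<theta>' < \<theta> \<and> g \<theta> - g \<theta>' < \<theta> - \<theta>' \<and>
        \<theta> < \<theta>'' \<and> (\<alpha> = 0 \<or> \<alpha> * (\<theta>'' - \<theta>) < g \<theta>'' - g \<theta>) \<and> \<alpha> \<ge> 0 \<and> v - e < \<theta> * \<alpha> - g \<theta>)"
  proof (cases "\<rho> = 0")
    case True
    have v: "v = - y" using assms True by (simp add: rpow_def)
    have g: "g \<theta> = y" if "\<theta> > 0" for \<theta> using that True by (simp add: g_def)
    show ?thesis
    proof (intro conjI allI impI)
      fix e :: real assume "e > 0"
      then show "\<exists>\<theta>>0. \<theta> - g \<theta> < v + e" by (intro exI[of _ "e / 2"]) (simp add: v g)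
      \<comment> \<open>As \<open>g\<close> is constant, any increasing triple serves, and
        \<open>\<alpha> = 0\<close> gives the exponent \<open>- y\<close> exactly.\<close>
      show "\<exists>\<theta>' \<theta> \<theta>'' \<alpha>. 0 < \<theta>' \<and> \<theta>' < \<theta> \<and> g \<theta> - g \<theta>' < \<theta> - \<theta>' \<and>
        \<theta> < \<theta>'' \<and> (\<alpha> = 0 \<or> \<alpha> * (\<theta>'' - \<theta>) < g \<theta>'' - g \<theta>) \<and> \<alpha> \<ge> 0 \<and> v - e < \<theta> * \<alpha> - g \<theta>"
        using \<open>e > 0\<close> by (intro exI[of _ 1] exI[of _ 2] exI[of _ 3] exI[of _ 0]) (simp add: v g)
    qed
  next
    case False
    then have r: "0 < \<rho>" "\<rho> < 1" using assms by auto
    \<comment> \<open>The zero of the derivative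
      \<open>1 - y * \<rho> * \<theta> powr (\<rho> - 1)\<close>.\<close>
    define c where "c = (\<rho> * y) powr (1 / (1 - \<rho>))"
    have c: "c > 0" using r assms by (simp add: c_def)
    have c1: "c powr (\<rho> - 1) = 1 / (\<rho> * y)"
    proof -
      have "c powr (\<rho> - 1) = (\<rho> * y) powr (- 1)"
        unfolding c_def powr_powr using r by (intro arg_cong[where f = "\<lambda>t. (\<rho> * y) powr t"]) (simp add: field_simps)
      then show ?thesis using r assms by (simp add: powr_minus_divide)
    qed
    have cr: "c powr \<rho> = c / (\<rho> * y)"
    proof -
      have "c powr \<rho> = c powr (1 + (\<rho> - 1))" by simp
      also have "\<dots> = c powr 1 * c powr (\<rho> - 1)" by (rule powr_add)
      finally show ?thesis using c c1 by simp
    qed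
    have v: "v = c - g c"
    proof -
      have "(\<rho> powr \<rho> * y) powr (1 / (1 - \<rho>)) = (\<rho> * y * \<rho> powr (\<rho> - 1)) powr (1 / (1 - \<rho>))"
        using r by (simp add: powr_diff mult.commute)
      also have "\<dots> = c * (\<rho> powr (\<rho> - 1)) powr (1 / (1 - \<rho>))"
        using r assms by (simp add: c_def powr_mult)
      also have "(\<rho> powr (\<rho> - 1)) powr (1 / (1 - \<rho>)) = \<rho> powr (- 1)"
        unfolding powr_powr using r by (intro arg_cong[where f = "\<lambda>t. \<rho> powr t"]) (simp add: field_simps)
      finally have "(\<rho> powr \<rho> * y) powr (1 / (1 - \<rho>)) = c / \<rho>" using r by (simp add: powr_minus_divide)
      then show ?thesis using r assms by (simp add: v_def g_def rpow_def cr field_simps)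
    qed
    have dg: "(g has_real_derivative (y * \<rho> * t powr (\<rho> - 1))) (at t)" if "t > 0" for t
      unfolding g_def using that by (auto intro!: derivative_eq_intros)
    show ?thesis
    proof (intro conjI allI impI)
      fix e :: real assume "e > 0"
      then show "\<exists>\<theta>>0. \<theta> - g \<theta> < v + e" using c v by (intro exI[of _ c]) auto
      \<comment> \<open>\<open>f \<delta>\<close> is the exponent
        \<open>\<theta> * \<alpha> - g \<theta>\<close> for \<open>\<theta> = c + \<delta>\<close>
        and \<alpha> equal to \<open>1 - \<delta>\<close> times the slope of \<open>g\<close> at
        \<theta>. It tends to \<open>c - g c = v\<close> because the slope at \<open>c\<close> is
        1.\<close>
      define f where "f = (\<lambda>\<delta>. (c + \<delta>) * ((1 - \<delta>) * (y * \<rho> * (c + \<delta>) powr (\<rho> - 1))) - g (c + \<delta>))"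
      have "(f \<longlongrightarrow> (c + 0) * ((1 - 0) * (y * \<rho> * (c + 0) powr (\<rho> - 1))) - y * (c + 0) powr \<rho>) (at_right 0)"
        unfolding f_def g_def using c by (intro tendsto_intros) auto
      also have "(c + 0) * ((1 - 0) * (y * \<rho> * (c + 0) powr (\<rho> - 1))) - y * (c + 0) powr \<rho> = v"
        using r assms(3) by (simp add: v c1 g_def)
      finally have "\<forall>\<^sub>F \<delta> in at_right 0. v - e < f \<delta>" using \<open>e > 0\<close> by (intro order_tendstoD(1)) auto
      moreover have "\<forall>\<^sub>F \<delta> in at_right (0::real). 0 < \<delta> \<and> \<delta> < 1"
        by (auto simp: eventually_at_right_less eventually_at_right_real eventually_conj_iff
            intro: eventually_at_right_real[of 0 1, simplified, THEN eventually_mono])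
      ultimately have "\<forall>\<^sub>F \<delta> in at_right 0. v - e < f \<delta> \<and> 0 < \<delta> \<and> \<delta> < 1" by eventually_elim auto
      then obtain \<delta> where d: "v - e < f \<delta>" "0 < \<delta>" "\<delta> < 1"
        using eventually_happens'[OF trivial_limit_at_right_real] by blast
      define \<theta> where "\<theta> = c + \<delta>"
      define g' where "g' = y * \<rho> * \<theta> powr (\<rho> - 1)"
      define \<alpha> where "\<alpha> = (1 - \<delta>) * g'"
      have th: "\<theta> > 0" "c < \<theta>" using c d by (auto simp: \<theta>_def)
      have "\<theta> powr (\<rho> - 1) < c powr (\<rho> - 1)" using th c r by (intro powr_less_mono2_neg) auto
      then have "g' < y * \<rho> * c powr (\<rho> - 1)" unfolding g'_def using r assms by (intro mult_strict_left_mono) auto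
      then have g'1: "g' < 1" using r assms by (simp add: c1)
      have g'0: "g' > 0" using r assms th by (simp add: g'_def)
      \<comment> \<open>Beyond \<open>c\<close> the slope of \<open>g\<close> is below 1, so a small
        step to the left yields \<theta>'. Likewise \<alpha> is below the slope, so a small step to
        the right yields \<theta>''.\<close>
      have "((\<lambda>t. t - g t) has_real_derivative (1 - g')) (at \<theta>)"
        unfolding g'_def by (intro derivative_intros dg th)
      from DERIV_pos_inc_left[OF this] g'1 obtain d1 where d1: "d1 > 0"
        "\<And>h. 0 < h \<Longrightarrow> h < d1 \<Longrightarrow> (\<theta> - h) - g (\<theta> - h) < \<theta> - g \<theta>" by auto
      have "((\<lambda>t. g t - \<alpha> * t) has_real_derivative (g' - \<alpha>)) (at \<theta>)"
        unfolding g'_def by (auto intro!: derivative_eq_intros dg th)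
      moreover have "g' - \<alpha> > 0" using g'0 d by (simp add: \<alpha>_def algebra_simps)
      ultimately obtain d2 where d2: "d2 > 0"
        "\<And>h. 0 < h \<Longrightarrow> h < d2 \<Longrightarrow> g \<theta> - \<alpha> * \<theta> < g (\<theta> + h) - \<alpha> * (\<theta> + h)"
        using DERIV_pos_inc_right by blast
      have "\<alpha> \<ge> 0" using g'0 d by (simp add: \<alpha>_def)
      define h1 where "h1 = min (d1 / 2) (\<theta> / 2)"
      have h1: "0 < h1" "h1 < d1" "h1 < \<theta>" using d1 th by (auto simp: h1_def min_def)
      have val: "v - e < \<theta> * \<alpha> - g \<theta>" using d(1) by (simp only: f_def \<alpha>_def g'_def \<theta>_def)
      have "0 < \<theta> - h1 \<and> \<theta> - h1 < \<theta> \<and> g \<theta> - g (\<theta> - h1) < \<theta> - (\<theta> - h1) \<and>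
        \<theta> < \<theta> + d2 / 2 \<and> (\<alpha> = 0 \<or> \<alpha> * (\<theta> + d2 / 2 - \<theta>) < g (\<theta> + d2 / 2) - g \<theta>) \<and> \<alpha> \<ge> 0 \<and>
        v - e < \<theta> * \<alpha> - g \<theta>"
        using h1 d1(2)[of h1] d2(1) d2(2)[of "d2 / 2"] val \<open>\<alpha> \<ge> 0\<close>
        by (auto simp: algebra_simps)
      then show "\<exists>\<theta>' \<theta> \<theta>'' \<alpha>. 0 < \<theta>' \<and> \<theta>' < \<theta> \<and> g \<theta> - g \<theta>' < \<theta> - \<theta>' \<and>
        \<theta> < \<theta>'' \<and> (\<alpha> = 0 \<or> \<alpha> * (\<theta>'' - \<theta>) < g \<theta>'' - g \<theta>) \<and> \<alpha> \<ge> 0 \<and> v - e < \<theta> * \<alpha> - g \<theta>"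
        by blast
    qed
  qed
  then show "\<And>e. e > 0 \<Longrightarrow> \<exists>\<theta>>0. \<theta> - g \<theta> < v + e"
    and "\<And>e. e > 0 \<Longrightarrow> \<exists>\<theta>' \<theta> \<theta>'' \<alpha>. 0 < \<theta>' \<and> \<theta>' < \<theta> \<and> g \<theta> - g \<theta>' < \<theta> - \<theta>' \<and>
        \<theta> < \<theta>'' \<and> (\<alpha> = 0 \<or> \<alpha> * (\<theta>'' - \<theta>) < g \<theta>'' - g \<theta>) \<and> \<alpha> \<ge> 0 \<and> v - e < \<theta> * \<alpha> - g \<theta>"
    by blast+
qed

section \<open>Difference quotients at 0 along sequences\<close>

lemma tendsto_one_minus_exp_div:
  fixes x :: "nat \<Rightarrow> real"
  assumes "x \<longlonglongrightarrow> 0" "\<forall>\<^sub>F n in sequentially. x n > 0"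
  shows "(\<lambda>n. (1 - exp (- \<theta> * x n)) / x n) \<longlonglongrightarrow> \<theta>"
proof -
  have "((\<lambda>t. - exp (- \<theta> * t)) has_real_derivative \<theta>) (at 0)"
    by (auto intro!: derivative_eq_intros)
  then have "(\<lambda>h. (- exp (- \<theta> * (0 + h)) - (- exp (- \<theta> * 0))) / h) \<midarrow>0\<rightarrow> \<theta>"
    by (rule DERIV_D)
  moreover have "filterlim x (at 0) sequentially"
    using assms by (auto simp: filterlim_at elim: eventually_mono)
  ultimately show ?thesis using filterlim_compose by fastforce
qed

lemma tendsto_ln_one_minus_div:
  fixes x :: "nat \<Rightarrow> real"
  assumes "x \<longlonglongrightarrow> 0" "\<forall>\<^sub>F n in sequentially. x n > 0"
  shows "(\<lambda>n. ln (1 - x n) / x n) \<longlonglongrightarrow> - 1"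
proof -
  have "((\<lambda>t. ln (1 - t)) has_real_derivative - 1) (at 0)"
    by (auto intro!: derivative_eq_intros)
  then have "(\<lambda>h. (ln (1 - (0 + h)) - ln (1 - 0)) / h) \<midarrow>0\<rightarrow> (- 1 :: real)"
    by (rule DERIV_D)
  moreover have "filterlim x (at 0) sequentially"
    using assms by (auto simp: filterlim_at elim: eventually_mono)
  ultimately show ?thesis using filterlim_compose by fastforce
qed

section \<open>Application of the tilting estimates to the ladder epochs\<close>

theorem theorem7:
  fixes M :: "'a measure" and X :: "nat \<Rightarrow> 'a \<Rightarrow> real"
    and \<rho> :: real and a :: "nat \<Rightarrow> real" and y :: real
  assumes "prob_space M"
    and "prob_space.indep_vars M (\<lambda>_. borel) X UNIV"
    and "\<And>i. distr M borel (X i) = distr M borel (X 0)"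
    and "\<not> (\<exists>c. AE \<omega> in M. X 0 \<omega> = c)"
    and "(0 < \<rho> \<and> \<rho> < 1 \<and> prob_nonneg M X \<longlonglongrightarrow> \<rho>) \<or>
         (\<rho> = 0 \<and> prob_nonneg M X \<longlonglongrightarrow> 0 \<and>
          \<not> summable (\<lambda>k. prob_nonneg M X (Suc k) / real (Suc k)))"
    and "\<And>n. n \<ge> 1 \<Longrightarrow> a n > 0"
    and "filterlim a at_top sequentially"
    and "(\<lambda>n. a n / real n powr (1 - \<rho>)) \<longlonglongrightarrow> 0"
    and "y > 0"
  shows "(\<lambda>n. 1 / a n powr (1 / (1 - \<rho>)) *
            ln (\<P>(\<omega> in M. real (num_records X n \<omega>) /
                  (C_fun M X \<rho> (1 - a n powr (1 / (1 - \<rho>)) / real n) * rpow (real n) \<rho> * a n) \<ge> y)))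
         \<longlonglongrightarrow> - (1 - \<rho>) * (rpow \<rho> \<rho> * y) powr (1 / (1 - \<rho>))"
proof -
  interpret prob_space M by fact
  interpret iid_steps M X by unfold_locales (use assms(2,3) in auto)
  define p where "p = prob_nonneg M X"
  define L where "L = log_series p"
  define b where "b = (\<lambda>n. a n powr (1 / (1 - \<rho>)))"
  define D where "D = (\<lambda>n. C_fun M X \<rho> (1 - b n / real n) * rpow (real n) \<rho> * a n)"
  \<comment> \<open>At least \<open>y * D n\<close> records amount to at least the ceiling of it;
    the subtracted 1 is the initial record, which \<open>rec_count\<close> omits.\<close>
  define r where "r = (\<lambda>n. nat \<lceil>y * D n\<rceil> - 1)"
  have rho: "0 \<le> \<rho>" "\<rho> < 1" and p_lim: "p \<longlonglongrightarrow> \<rho>" using assms(5) by (auto simp: p_def)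
  have p_bounds: "0 \<le> p k" "p k \<le> 1" "\<bar>p k\<bar> \<le> 1" for k
    using prob_nonneg_bounds abs_prob_nonneg_le by (auto simp: p_def)
  have p_div: "\<not> summable (\<lambda>k. p (Suc k) / real (Suc k))"
    using assms(5) not_summable_of_limit_pos[of p \<rho>] p_lim by (auto simp: p_def)
  have a_pos: "\<forall>\<^sub>F n in sequentially. a n > 0"
    using eventually_ge_at_top[of 1] by eventually_elim (use assms(6) in auto)

  have b_top: "filterlim b at_top sequentially"
    unfolding b_def using rho
    by (intro filterlim_compose[OF real_powr_at_top assms(7)]) auto
  have b_pos: "\<forall>\<^sub>F n in sequentially. b n > 0"
    using b_top by (auto simp: filterlim_at_top_dense)
  have b_small: "(\<lambda>n. b n / real n) \<longlonglongrightarrow> 0"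
  proof -
    have "(\<lambda>n. (a n / real n powr (1 - \<rho>)) powr (1 / (1 - \<rho>))) \<longlonglongrightarrow> 0"
      by (rule tendsto_zero_powrI[OF assms(8) tendsto_const])
         (use rho a_pos in \<open>auto elim: eventually_mono\<close>)
    then show ?thesis
    proof (rule Lim_transform_eventually)
      show "\<forall>\<^sub>F n in sequentially. (a n / real n powr (1 - \<rho>)) powr (1 / (1 - \<rho>)) = b n / real n"
        using a_pos eventually_gt_at_top[of 0]
        by eventually_elim (use rho in \<open>simp add: b_def powr_divide powr_powr\<close>)
    qed
  qed
  have x_pos: "\<forall>\<^sub>F n in sequentially. b n / real n > 0"
    using b_pos eventually_gt_at_top[of 0] by eventually_elim simp
  have x_lt: "\<forall>\<^sub>F n in sequentially. b n / real n < 1"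
    using b_small by (intro order_tendstoD(2)) auto
  define u where "u = (\<lambda>n. 1 - b n / real n)"
  have u_lim: "u \<longlonglongrightarrow> 1" unfolding u_def using tendsto_diff[OF tendsto_const b_small, of 1] by simp
  have u_bounds: "\<forall>\<^sub>F n in sequentially. 0 < u n \<and> u n < 1"
    unfolding u_def using x_pos x_lt by eventually_elim auto
  have L_top: "filterlim (\<lambda>n. L (s n)) at_top sequentially"
    if "s \<longlonglongrightarrow> 1" "\<forall>\<^sub>F n in sequentially. 0 < s n \<and> s n < 1" for s
    unfolding L_def using p_bounds by (intro log_series_at_top p_div that) auto

  \<comment> \<open>The powers of \<open>n\<close> cancel and
    \<open>b n powr \<rho> * a n = b n\<close>, so the normalisation is
    \<open>b n / (1 - ladder_gf (u n))\<close>.\<close>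
  have D_eq: "\<forall>\<^sub>F n in sequentially. D n = b n * exp (L (u n))"
    using a_pos u_bounds x_pos eventually_gt_at_top[of 0]
  proof eventually_elim
    case (elim n)
    have 1: "rpow (real n) \<rho> = real n powr \<rho>" using elim by (simp add: rpow_def)
    have 2: "(b n / real n) powr \<rho> * real n powr \<rho> = b n powr \<rho>"
      using elim by (simp add: powr_mult[symmetric] b_def)
    have 3: "b n powr \<rho> * a n = b n"
    proof -
      have "b n powr \<rho> * a n = a n powr (\<rho> / (1 - \<rho>)) * a n powr 1"
        using elim by (simp add: b_def powr_powr)
      also have "\<dots> = a n powr (\<rho> / (1 - \<rho>) + 1)" by (rule powr_add[symmetric])
      also have "\<rho> / (1 - \<rho>) + 1 = 1 / (1 - \<rho>)" using rho by (simp add: field_simps)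
      finally show ?thesis by (simp add: b_def)
    qed
    have 4: "C_fun M X \<rho> (u n) = exp (L (u n)) * (b n / real n) powr \<rho>"
      using elim by (subst C_fun_eq) (auto simp: L_def p_def u_def)
    have "D n = C_fun M X \<rho> (u n) * rpow (real n) \<rho> * a n" by (simp add: D_def u_def)
    also have "\<dots> = exp (L (u n)) * (((b n / real n) powr \<rho> * real n powr \<rho>) * a n)"
      unfolding 1 4 by (simp only: mult.assoc)
    finally show ?case unfolding 2 3 by (simp only: mult.commute)
  qed
  have D_top: "filterlim D at_top sequentially"
  proof (rule filterlim_at_top_mono[OF b_top])
    show "\<forall>\<^sub>F n in sequentially. b n \<le> D n"
      using D_eq b_pos filterlim_at_top[THEN iffD1, OF L_top[OF u_lim u_bounds], rule_format, of 0]
      by eventually_elim simp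
  qed
  have D_pos: "\<forall>\<^sub>F n in sequentially. D n > 0"
    using D_top by (auto simp: filterlim_at_top_dense)
  have r_lim: "(\<lambda>n. real (r n) / D n) \<longlonglongrightarrow> y"
  proof (rule tendsto_sandwich)
    show "(\<lambda>n. y - 1 / D n) \<longlonglongrightarrow> y"
      using tendsto_diff[OF tendsto_const real_tendsto_divide_at_top[OF tendsto_const D_top], of y 1] by simp
    show "(\<lambda>n. y + 1 / D n) \<longlonglongrightarrow> y"
      using tendsto_add[OF tendsto_const real_tendsto_divide_at_top[OF tendsto_const D_top], of y 1] by simp
    have r_bounds: "y * D n - 1 \<le> real (r n) \<and> real (r n) \<le> y * D n + 1" if "D n > 0" for n
    proof -
      have "0 < y * D n" using that assms(9) by simp
      then have "real (nat \<lceil>y * D n\<rceil>) = of_int \<lceil>y * D n\<rceil>" "nat \<lceil>y * D n\<rceil> \<ge> 1"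
        by (auto simp: Suc_le_eq)
      then have "real (r n) = of_int \<lceil>y * D n\<rceil> - 1" by (simp only: r_def of_nat_diff of_nat_1)
      then show ?thesis by linarith
    qed
    show "\<forall>\<^sub>F n in sequentially. y - 1 / D n \<le> real (r n) / D n"
      using D_pos
    proof eventually_elim
      case (elim n)
      then have "(y * D n - 1) / D n \<le> real (r n) / D n" using r_bounds by (intro divide_right_mono) auto
      then show ?case using elim by (simp add: diff_divide_distrib)
    qed
    show "\<forall>\<^sub>F n in sequentially. real (r n) / D n \<le> y + 1 / D n"
      using D_pos
    proof eventually_elim
      case (elim n)
      then have "real (r n) / D n \<le> (y * D n + 1) / D n" using r_bounds by (intro divide_right_mono) auto
      then show ?case using elim by (simp add: add_divide_distrib)
    qed
  qed

  have G_lim: "(\<lambda>n. ln (ladder_gf (exp (- \<theta> * b n / real n)) ^ r n) / b n) \<longlonglongrightarrow> - (y * \<theta> powr \<rho>)"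
    if th: "\<theta> > 0" for \<theta>
  proof -
    define s where "s = (\<lambda>n. exp (- \<theta> * b n / real n))"
    \<comment> \<open>\<open>\<psi> n\<close> is \<open>1 - ladder_gf (s n)\<close> and tends to 0,
      so the logarithm of the \<open>r n\<close>-th power behaves like
      \<open>- r n * \<psi> n\<close>. By \<open>D_eq\<close>, \<open>r n * \<psi> n / b n\<close>
      is \<open>r n / D n\<close> times \<open>exp (L (u n) - L (s n))\<close>, with limits
      \<open>y\<close> and \<open>\<theta> powr \<rho>\<close>.\<close>
    define \<psi> where "\<psi> = (\<lambda>n. exp (- L (s n)))"
    have "(\<lambda>n. exp (- \<theta> * (b n / real n))) \<longlonglongrightarrow> exp (- \<theta> * 0)"
      by (intro tendsto_intros b_small)
    then have s_lim: "s \<longlonglongrightarrow> 1" by (simp add: s_def)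
    have s_bounds: "\<forall>\<^sub>F n in sequentially. 0 < s n \<and> s n < 1"
      unfolding s_def using b_pos eventually_gt_at_top[of 0]
      by eventually_elim (use th in \<open>simp add: divide_neg_pos\<close>)
    have "(\<lambda>n. (1 - exp (- \<theta> * (b n / real n))) / (b n / real n)) \<longlonglongrightarrow> \<theta>"
      by (rule tendsto_one_minus_exp_div[OF b_small x_pos])
    then have "(\<lambda>n. (1 - s n) / (1 - u n)) \<longlonglongrightarrow> \<theta>" by (simp add: s_def u_def)
    then have "(\<lambda>n. L (u n) - L (s n)) \<longlonglongrightarrow> \<rho> * ln \<theta>"
      unfolding L_def using th
      by (intro log_series_regularly_varying[where B = 1] p_bounds p_lim u_lim u_bounds s_lim s_bounds)
    then have "(\<lambda>n. exp (L (u n) - L (s n))) \<longlonglongrightarrow> exp (\<rho> * ln \<theta>)" by (rule tendsto_exp)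
    moreover have "exp (\<rho> * ln \<theta>) = \<theta> powr \<rho>" using th by (simp add: powr_def)
    ultimately have ratio: "(\<lambda>n. exp (L (u n) - L (s n))) \<longlonglongrightarrow> \<theta> powr \<rho>" by simp
    have "\<psi> \<longlonglongrightarrow> 0"
      unfolding \<psi>_def using L_top[OF s_lim s_bounds]
      by (intro filterlim_compose[OF exp_at_bot] filterlim_uminus_at_bot[THEN iffD2]) simp
    then have "(\<lambda>n. ln (1 - \<psi> n) / \<psi> n) \<longlonglongrightarrow> - 1"
      by (rule tendsto_ln_one_minus_div) (simp add: \<psi>_def)
    from tendsto_mult[OF tendsto_mult[OF r_lim ratio] this]
    have "(\<lambda>n. real (r n) / D n * exp (L (u n) - L (s n)) * (ln (1 - \<psi> n) / \<psi> n)) \<longlonglongrightarrow> - (y * \<theta> powr \<rho>)"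
      by simp
    then show ?thesis
    proof (rule Lim_transform_eventually)
      have "\<forall>\<^sub>F n in sequentially. \<psi> n < 1"
        using \<open>\<psi> \<longlonglongrightarrow> 0\<close> by (intro order_tendstoD(2)) auto
      then show "\<forall>\<^sub>F n in sequentially. real (r n) / D n * exp (L (u n) - L (s n)) * (ln (1 - \<psi> n) / \<psi> n)
          = ln (ladder_gf (exp (- \<theta> * b n / real n)) ^ r n) / b n"
        using D_eq s_bounds b_pos
      proof eventually_elim
        case (elim n)
        have "ladder_gf (s n) = 1 - \<psi> n" using elim ladder_gf_eq[of "s n"] by (simp add: \<psi>_def L_def p_def)
        then have "ln (ladder_gf (s n) ^ r n) = real (r n) * ln (1 - \<psi> n)"
          using elim by (simp add: ln_realpow)
        moreover have "exp (L (u n) - L (s n)) = exp (L (u n)) * \<psi> n"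
          by (simp add: \<psi>_def exp_diff exp_minus divide_inverse)
        moreover have "\<psi> n \<noteq> 0" by (simp add: \<psi>_def)
        moreover have "exp (- \<theta> * b n / real n) = s n" by (simp add: s_def)
        ultimately show ?case using elim(2,4) by simp
      qed
    qed
  qed

  interpret T: exponential_tilting "\<lambda>n. ladder_prob (r n)" "\<lambda>n s. ladder_gf s ^ r n" b "\<lambda>\<theta>. y * \<theta> powr \<rho>"
    by unfold_locales (use ladder_prob_nonneg ladder_prob_sums_power b_top G_lim assms(9) in auto)
  have "(\<lambda>n. ln (\<Sum>m\<le>n. ladder_prob (r n) m) / b n) \<longlonglongrightarrow> - (1 - \<rho>) * (rpow \<rho> \<rho> * y) powr (1 / (1 - \<rho>))"
    by (rule T.log_prob_limit[OF legendre_value[OF rho assms(9)]])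
  then show ?thesis
  proof (rule Lim_transform_eventually)
    show "\<forall>\<^sub>F n in sequentially. ln (\<Sum>m\<le>n. ladder_prob (r n) m) / b n = 1 / a n powr (1 / (1 - \<rho>)) *
            ln (\<P>(\<omega> in M. real (num_records X n \<omega>) /
                  (C_fun M X \<rho> (1 - a n powr (1 / (1 - \<rho>)) / real n) * rpow (real n) \<rho> * a n) \<ge> y))"
      using D_pos
    proof eventually_elim
      case (elim n)
      have "y \<le> real (num_records X n \<omega>) / D n \<longleftrightarrow> r n \<le> rec_count (\<lambda>i. X i \<omega>) n" for \<omega>
      proof -
        have "y \<le> real (num_records X n \<omega>) / D n \<longleftrightarrow> y * D n \<le> real (num_records X n \<omega>)"
          using elim by (simp add: le_divide_eq)
        also have "\<dots> \<longleftrightarrow> nat \<lceil>y * D n\<rceil> \<le> num_records X n \<omega>" by (rule nat_ceiling_le_eq[symmetric])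
        also have "\<dots> \<longleftrightarrow> r n \<le> rec_count (\<lambda>i. X i \<omega>) n" unfolding r_def num_records_eq by linarith
        finally show ?thesis .
      qed
      then have "\<P>(\<omega> in M. real (num_records X n \<omega>) / D n \<ge> y) = (\<Sum>m\<le>n. ladder_prob (r n) m)"
        by (simp add: prob_rec_count_ge)
      then show ?case unfolding D_def b_def by simp
    qed
  qed
qed

end
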